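(* Let $d\ge 1$ be an integer and let $\mu$ be a locally finite measure on $(0,+\infty)$. Consider the two assertions: (A1) $\sup_{r>0} r^d\,\mu([r,+\infty))<\infty$; (A2) $\int_{[1,+\infty)}\beta^d\,\mu(d\beta)<\infty$. If $d\ge 2$, then there exists $\lambda_0>0$ such that $P_{\lambda,\mu}(\text{percolation})=0$ for all $\lambda\in(0,\lambda_0)$ if and only if both (A1) and (A2) hold. If $d=1$, then (A1) and (A2) together are sufficient for the existence of $\lambda_0>0$ such that $P_{\lambda,\mu}(\text{percolation})=0$ for all $\lambda\in(0,\lambda_0)$, and (A2) is a necessary condition for the existence of such a $\lambda_0$.
   Context: $|\cdot|$ is Lebesgue measure on $\mathbb{R}^d$ and $B(x,r)$ is the open Euclidean ball with center $x$ and radius $r$. Locally finite on $(0,+\infty)$ means finite on compact subsets of $(0,+\infty)$. For $\lambda>0$, $\xi$ is a Poisson point process on $\mathbb{R}^d\times(0,+\infty)$ whose intensity measure is the product of $\lambda|\cdot|$ and $\mu$; $P_{\lambda,\mu}$ is the associated probability measure. Set $\Sigma=\bigcup_{(c,r)\in\xi}B(c,r)$, and let $S$ be the connected component of $\Sigma$ containing $0$ ($S=\varnothing$ if $0\notin\Sigma$). The event $\{\text{percolation}\}$ is $\{S\text{ is unbounded}\}$. *)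

theory Defs
  imports "HOL-Probability.Probability"
begin

text \<open>
  A point process is modelled as a random set of points; the number of points in \<open>A\<close> is the
  counting measure of the trace on \<open>A\<close>, with value \<open>\<infinity>\<close> if there are infinitely many.
  No multiplicities are needed here, because the intensity measures of interest have no atoms
  (the first factor is a multiple of Lebesgue measure), so that the process is almost surely simple.
\<close>

definition point_count :: "('w \<Rightarrow> 'b set) \<Rightarrow> 'b set \<Rightarrow> 'w \<Rightarrow> ennreal" where
  "point_count \<xi> A \<omega> = emeasure (count_space UNIV) (\<xi> \<omega> \<inter> A)"

text \<open>
  The Poisson law is written out instead of using \<open>poisson_pmf\<close>, since the latter is only
  specified for a positive rate; here the rate \<open>0\<close> gives the point mass at \<open>0\<close>.
\<close>

definition poisson_point_process ::
    "'w measure \<Rightarrow> ('w \<Rightarrow> 'b set) \<Rightarrow> 'b measure \<Rightarrow> bool" where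
  "poisson_point_process M \<xi> \<nu> \<longleftrightarrow>
     prob_space M \<and>
     (\<forall>\<omega>\<in>space M. \<xi> \<omega> \<subseteq> space \<nu>) \<and>
     (\<forall>A\<in>sets \<nu>. point_count \<xi> A \<in> borel_measurable M) \<and>
     (\<forall>A\<in>sets \<nu>. emeasure \<nu> A < \<infinity> \<longrightarrow>
        (\<forall>n. measure M {\<omega>\<in>space M. point_count \<xi> A \<omega> = of_nat n} =
               measure \<nu> A ^ n / fact n * exp (- measure \<nu> A))) \<and>
     (\<forall>A\<in>sets \<nu>. emeasure \<nu> A = \<infinity> \<longrightarrow> (AE \<omega> in M. point_count \<xi> A \<omega> = \<infinity>)) \<and>
     (\<forall>\<A>. finite \<A> \<and> \<A> \<subseteq> sets \<nu> \<and> disjoint \<A> \<longrightarrow>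
        prob_space.indep_vars M (\<lambda>_. borel) (point_count \<xi>) \<A>)"

definition locally_finite_on_pos :: "real measure \<Rightarrow> bool" where
  "locally_finite_on_pos \<mu> \<longleftrightarrow>
     sets \<mu> = sets (restrict_space borel {0<..}) \<and>
     (\<forall>K. compact K \<and> K \<subseteq> {0<..} \<longrightarrow> emeasure \<mu> K < \<infinity>)"

definition boolean_intensity :: "real \<Rightarrow> real measure \<Rightarrow> ('a::euclidean_space \<times> real) measure" where
  "boolean_intensity lam \<mu> = scale_measure (ennreal lam) lborel \<Otimes>\<^sub>M \<mu>"

definition covered_set :: "('a::euclidean_space \<times> real) set \<Rightarrow> 'a set" where
  "covered_set X = (\<Union>(c, r)\<in>X. ball c r)"

text \<open>Note that \<open>connected_component_set U x\<close> is empty if \<open>x \<notin> U\<close>.\<close>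

definition percolates :: "('a::euclidean_space \<times> real) set \<Rightarrow> bool" where
  "percolates X \<longleftrightarrow> \<not> bounded (connected_component_set (covered_set X) 0)"

text \<open>
  \<open>P lam\<close> is the probability measure of the model with parameter \<open>lam\<close>, and \<open>\<xi> lam\<close> the Poisson process
  defined under it. Membership in \<open>null_sets\<close> says that the percolation event is measurable and
  has probability \<open>0\<close> (for a non-measurable set \<open>measure\<close> would be \<open>0\<close> by convention).
\<close>

definition has_subcritical_regime ::
    "(real \<Rightarrow> 'w measure) \<Rightarrow> (real \<Rightarrow> 'w \<Rightarrow> ('a::euclidean_space \<times> real) set) \<Rightarrow> bool" where
  "has_subcritical_regime P \<xi> \<longleftrightarrow>
     (\<exists>lam0>0. \<forall>lam\<in>{0<..<lam0}. {\<omega>\<in>space (P lam). percolates (\<xi> lam \<omega>)} \<in> null_sets (P lam))"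

definition A1 :: "nat \<Rightarrow> real measure \<Rightarrow> bool" where
  "A1 d \<mu> \<longleftrightarrow> (SUP r\<in>{0<..}. ennreal (r ^ d) * emeasure \<mu> {r..}) < \<infinity>"

definition A2 :: "nat \<Rightarrow> real measure \<Rightarrow> bool" where
  "A2 d \<mu> \<longleftrightarrow> (\<integral>\<^sup>+\<beta>\<in>{1..}. ennreal (\<beta> ^ d) \<partial>\<mu>) < \<infinity>"

end

theory Submission
  imports Defs
begin

text \<open>
  Everything is expressed through the avoidance events \<open>\<xi> \<inter> A = {}\<close>, whose probability is
  \<open>exp (- \<nu> A)\<close>; they form an intersection-stable family, so disjoint regions are independent.

  Sufficiency: let \<open>p(L)\<close> be the supremum over \<open>x\<close> of the probability that a chain of balls of
  radius at most \<open>L\<close> leads from \<open>ball x L\<close> to the outside of \<open>ball x (2 * L)\<close>. A crossing at scale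
  \<open>24 * L\<close> made of balls of radius at most \<open>L\<close> contains two crossings at scale \<open>L\<close>, one near the
  sphere of radius \<open>30 * L\<close> and one near that of radius \<open>42 * L\<close>, which are independent. Hence
  \<open>p(24 * L) \<le> N\<^sup>2 * p(L)\<^sup>2 + C * lam * L ^ d * \<mu> {L..}\<close>. If radii below \<open>e\<close> are ignored,
  \<open>p(L) = 0\<close> for \<open>L < e\<close>, so for small \<open>lam\<close> condition (A1) makes \<open>p\<close> uniformly small, first for every
  \<open>e > 0\<close> and then, since chains are finite, for \<open>e = 0\<close>. With (A2) the error term tends to \<open>0\<close>, and
  so does \<open>p(24 ^ n)\<close>.

  Necessity: if (A2) fails, every ball around the origin is almost surely covered by a single ball
  of the process. If (A1) fails, then for any \<open>lam\<close> there is \<open>r\<close> such that cells of side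
  \<open>r / (d + 1)\<close> fail to contain the centre of a ball of radius at least \<open>r\<close> with arbitrarily
  small probability, and Peierls' argument applies.
\<close>

section \<open>Poisson point processes and chains of balls\<close>

locale poisson_process =
  fixes M :: "'w measure" and \<xi> :: "'w \<Rightarrow> 'b set" and \<nu> :: "'b measure"
  assumes poisson: "poisson_point_process M \<xi> \<nu>"
begin

sublocale prob_space M
  using poisson by (simp add: poisson_point_process_def)

lemma points_in_space: "\<omega> \<in> space M \<Longrightarrow> \<xi> \<omega> \<subseteq> space \<nu>"
  using poisson by (auto simp: poisson_point_process_def)

definition void :: "'b set \<Rightarrow> 'w set" where
  "void A = {\<omega> \<in> space M. \<xi> \<omega> \<inter> A = {}}"

text \<open>The information carried by the process inside \<open>D\<close>, generated by avoidance
  events alone instead of counts: their probabilities are explicit and, by \<open>void_Int\<close>,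
  they are stable under intersection. The generators use measurable subsets of \<open>D\<close>, so
  the definition makes sense for every \<open>D\<close>.\<close>

definition void_algebra :: "'b set \<Rightarrow> 'w set set" where
  "void_algebra D = sigma_sets (space M) {void A | A. A \<in> sets \<nu> \<and> A \<subseteq> D}"

lemma point_count_eq_0_iff: "point_count \<xi> A \<omega> = 0 \<longleftrightarrow> \<xi> \<omega> \<inter> A = {}"
  unfolding point_count_def
  by (subst emeasure_count_space_eq_0) auto

lemma void_eq: "void A = {\<omega> \<in> space M. point_count \<xi> A \<omega> = 0}"
  by (auto simp: void_def point_count_eq_0_iff)

lemma void_in_events [measurable]: "A \<in> sets \<nu> \<Longrightarrow> void A \<in> events"
proof -
  assume "A \<in> sets \<nu>"
  then have "point_count \<xi> A \<in> borel_measurable M"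
    using poisson by (auto simp: poisson_point_process_def)
  then show ?thesis
    unfolding void_eq by measurable
qed

lemma void_Int: "void A \<inter> void B = void (A \<union> B)"
  by (auto simp: void_def)

lemma prob_void_finite:
  assumes "A \<in> sets \<nu>" "emeasure \<nu> A < \<infinity>"
  shows "prob (void A) = exp (- measure \<nu> A)"
proof -
  have "\<forall>n. measure M {\<omega>\<in>space M. point_count \<xi> A \<omega> = of_nat n} =
      measure \<nu> A ^ n / fact n * exp (- measure \<nu> A)"
    using poisson assms by (auto simp: poisson_point_process_def)
  from this[rule_format, of 0] show ?thesis
    by (simp add: void_eq)
qed

lemma prob_void_infinite:
  assumes "A \<in> sets \<nu>" "emeasure \<nu> A = \<infinity>"
  shows "prob (void A) = 0"
proof -
  have ae: "AE \<omega> in M. point_count \<xi> A \<omega> = \<infinity>"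
    using poisson assms by (auto simp: poisson_point_process_def)
  have "AE \<omega> in M. \<omega> \<notin> void A"
    using ae by eventually_elim (auto simp: void_eq)
  then show ?thesis
    using void_in_events[OF assms(1)] by (simp add: prob_eq_0)
qed

text \<open>If both intensities are finite, additivity of \<open>\<nu>\<close> becomes
  multiplicativity of the exponential. If one of them is infinite, then so is that of the union, and
  both sides are 0.\<close>

lemma prob_void_Un:
  assumes A: "A \<in> sets \<nu>" and B: "B \<in> sets \<nu>" and disj: "A \<inter> B = {}"
  shows "prob (void (A \<union> B)) = prob (void A) * prob (void B)"
proof (cases "emeasure \<nu> A < \<infinity> \<and> emeasure \<nu> B < \<infinity>")
  case True
  then have "emeasure \<nu> (A \<union> B) = emeasure \<nu> A + emeasure \<nu> B"
    using A B disj by (simp add: plus_emeasure)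
  moreover from True have "measure \<nu> (A \<union> B) = measure \<nu> A + measure \<nu> B"
    using A B disj by (intro measure_Union) auto
  ultimately show ?thesis
    using True A B by (subst (1 2 3) prob_void_finite) (auto simp: exp_add[symmetric])
next
  case False
  have "emeasure \<nu> A \<le> emeasure \<nu> (A \<union> B)" "emeasure \<nu> B \<le> emeasure \<nu> (A \<union> B)"
    using A B by (auto intro!: emeasure_mono)
  with False have "emeasure \<nu> (A \<union> B) = \<infinity>" and "emeasure \<nu> A = \<infinity> \<or> emeasure \<nu> B = \<infinity>"
    by (auto simp: not_less_iff_gr_or_eq[of _ top] top_unique neq_top_trans less_top[symmetric])
  then show ?thesis
    using A B prob_void_infinite by auto
qed

lemma prob_hit_le:
  assumes "A \<in> sets \<nu>" "emeasure \<nu> A < \<infinity>"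
  shows "prob (space M - void A) \<le> measure \<nu> A"
proof -
  have "1 - measure \<nu> A \<le> exp (- measure \<nu> A)"
    using exp_ge_add_one_self[of "- measure \<nu> A"] by simp
  then show ?thesis
    using assms by (simp add: prob_compl prob_void_finite)
qed

lemma sigma_algebra_void_algebra: "sigma_algebra (space M) (void_algebra D)"
  unfolding void_algebra_def by (rule sigma_algebra_sigma_sets) (auto simp: void_def)

lemma void_algebra_subset_events: "void_algebra D \<subseteq> events"
  unfolding void_algebra_def by (rule sets.sigma_sets_subset) auto

lemma void_in_void_algebra: "A \<in> sets \<nu> \<Longrightarrow> A \<subseteq> D \<Longrightarrow> void A \<in> void_algebra D"
  unfolding void_algebra_def by (rule sigma_sets.Basic) auto

lemma hit_in_void_algebra:
  assumes "A \<in> sets \<nu>" "A \<subseteq> D"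
  shows "{\<omega> \<in> space M. \<xi> \<omega> \<inter> A \<noteq> {}} \<in> void_algebra D"
proof -
  interpret V: sigma_algebra "space M" "void_algebra D"
    by (rule sigma_algebra_void_algebra)
  have "{\<omega> \<in> space M. \<xi> \<omega> \<inter> A \<noteq> {}} = space M - void A"
    by (auto simp: void_def)
  then show ?thesis
    using void_in_void_algebra[OF assms] by auto
qed

text \<open>Dynkin's argument: the two generating families are intersection-stable and independent
  by \<open>prob_void_Un\<close>, so the generated sigma-algebras are independent too.\<close>

lemma prob_Int_void_algebra:
  assumes "D1 \<inter> D2 = {}" "E1 \<in> void_algebra D1" "E2 \<in> void_algebra D2"
  shows "prob (E1 \<inter> E2) = prob E1 * prob E2"
proof -
  let ?G = "\<lambda>D. {void A | A. A \<in> sets \<nu> \<and> A \<subseteq> D}"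
  have stable: "Int_stable (?G D)" for D
    by (force simp: Int_stable_def void_Int)
  have "indep_set (?G D1) (?G D2)"
    unfolding indep_sets2_eq
  proof (intro conjI ballI)
    fix a b assume "a \<in> ?G D1" "b \<in> ?G D2"
    then obtain A B where "a = void A" "A \<in> sets \<nu>" "A \<subseteq> D1" "b = void B" "B \<in> sets \<nu>" "B \<subseteq> D2"
      by blast
    then show "prob (a \<inter> b) = prob a * prob b"
      using assms(1) by (auto simp: void_Int intro!: prob_void_Un)
  qed auto
  from indep_set_sigma_sets[OF this stable stable]
  show ?thesis
    using assms(2,3) unfolding void_algebra_def by (rule indep_setD)
qed

end

section \<open>Chains of overlapping balls\<close>

text \<open>A pair is a centre with a radius. For positive radii the inequality says that the two
  open balls intersect; in this form it is visibly an open condition on pairs.\<close>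

definition adj :: "('a::metric_space \<times> real) \<Rightarrow> 'a \<times> real \<Rightarrow> bool" where
  "adj p q \<longleftrightarrow> dist (fst p) (fst q) < snd p + snd q"

definition link :: "('a::metric_space \<times> real) set \<Rightarrow> (('a \<times> real) \<times> ('a \<times> real)) set" where
  "link X = {(p, q). p \<in> X \<and> q \<in> X \<and> adj p q}"

text \<open>\<open>U\<close> is a condition on the first ball of a chain, such as containing the
  origin. Connection events thus take the form that a cluster hits a target set.\<close>

definition cluster :: "('a::metric_space \<times> real) set \<Rightarrow> ('a \<times> real) set \<Rightarrow> ('a \<times> real) set" where
  "cluster X U = (link X)\<^sup>* `` (X \<inter> U)"

lemma adj_sym: "adj p q \<Longrightarrow> adj q p"
  by (simp add: adj_def dist_commute add.commute)

lemma open_adj: "open {(p, q). adj p q}"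
  unfolding adj_def case_prod_unfold by (intro open_Collect_less continuous_intros)

lemma cluster_base: "p \<in> X \<Longrightarrow> p \<in> U \<Longrightarrow> p \<in> cluster X U"
  by (auto simp: cluster_def)

lemma cluster_step: "p \<in> cluster X U \<Longrightarrow> p \<in> X \<Longrightarrow> q \<in> X \<Longrightarrow> adj p q \<Longrightarrow> q \<in> cluster X U"
  unfolding cluster_def by (auto simp: link_def intro: rtrancl.rtrancl_into_rtrancl)

lemma cluster_induct [consumes 1, case_names base step]:
  assumes "q \<in> cluster X U"
    and base: "\<And>p. p \<in> X \<Longrightarrow> p \<in> U \<Longrightarrow> Q p"
    and step: "\<And>p q. p \<in> cluster X U \<Longrightarrow> p \<in> X \<Longrightarrow> q \<in> X \<Longrightarrow> Q p \<Longrightarrow> adj p q \<Longrightarrow> Q q"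
  shows "Q q"
proof -
  from assms(1) obtain p where p: "p \<in> X" "p \<in> U"
    and r: "(p, q) \<in> (link X)\<^sup>*"
    by (auto simp: cluster_def)
  from r have "q \<in> cluster X U \<and> Q q"
  proof induction
    case base
    then show ?case using p assms(2) by (auto intro: cluster_base)
  next
    case (step y z)
    then show ?case using assms(3)[of y z] by (auto simp: link_def intro: cluster_step)
  qed
  then show ?thesis ..
qed

lemma cluster_subset: "cluster X U \<subseteq> X"
proof
  fix q assume "q \<in> cluster X U"
  then show "q \<in> X" by (induction rule: cluster_induct) auto
qed

lemma cluster_mono:
  assumes "X \<subseteq> Y" "U \<subseteq> W"
  shows "cluster X U \<subseteq> cluster Y W"
proof
  fix q assume "q \<in> cluster X U"
  then show "q \<in> cluster Y W"
  proof (induction rule: cluster_induct)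
    case (base p)
    then show ?case using assms by (blast intro: cluster_base)
  next
    case (step p q)
    then show ?case using assms(1) by (blast intro: cluster_step)
  qed
qed

text \<open>Adjacency is symmetric, so the chain can be run backwards. The renormalization uses this
  to restart a long chain from a ball in its middle.\<close>

lemma cluster_sym:
  assumes "q \<in> cluster X U" "q \<in> W"
  shows "cluster X W \<inter> U \<noteq> {}"
proof -
  from assms obtain p where p: "p \<in> X" "p \<in> U" and r: "(p, q) \<in> (link X)\<^sup>*"
    by (auto simp: cluster_def)
  have "sym (link X)" by (auto simp: link_def sym_def adj_sym)
  then have "(q, p) \<in> (link X)\<^sup>*"
    using r by (rule symD[OF sym_rtrancl])
  moreover have "q \<in> X" using assms cluster_subset by blast
  ultimately show ?thesis
    using p assms by (auto simp: cluster_def)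
qed

lemma cluster_eq_UN_relpow:
  "cluster X U = (\<Union>n. (link X ^^ n) `` (X \<inter> U))"
  unfolding cluster_def by (simp add: rtrancl_is_UN_relpow) blast

text \<open>A chain is finite, so all its balls belong to one member of the increasing sequence.
  This later removes the lower cutoff on the radii.\<close>

lemma cluster_UN:
  assumes "incseq X"
  shows "cluster (\<Union>k. X k) U = (\<Union>k. cluster (X k) U)"
proof
  show "(\<Union>k. cluster (X k) U) \<subseteq> cluster (\<Union>k. X k) U"
    using cluster_mono[of "X _" "\<Union>k. X k" U U] by blast
  show "cluster (\<Union>k. X k) U \<subseteq> (\<Union>k. cluster (X k) U)"
  proof
    fix q assume "q \<in> cluster (\<Union>k. X k) U"
    then show "q \<in> (\<Union>k. cluster (X k) U)"
    proof (induction rule: cluster_induct)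
      case (base p)
      then show ?case by (auto intro: cluster_base)
    next
      case (step p q)
      then obtain i j where i: "p \<in> cluster (X i) U" and j: "q \<in> X j" by blast
      have p: "p \<in> cluster (X (max i j)) U"
        using cluster_mono[OF monoD[OF assms max.cobounded1] order_refl] i by (rule subsetD)
      have q: "q \<in> X (max i j)"
        using monoD[OF assms max.cobounded2] j by (rule subsetD)
      have "q \<in> cluster (X (max i j)) U"
        by (rule cluster_step[OF p subsetD[OF cluster_subset p] q \<open>adj p q\<close>])
      then show ?case by (rule UN_I[OF UNIV_I])
    qed
  qed
qed

section \<open>Measurability and sigma-finiteness of the intensity\<close>

lemma locally_finite_on_pos_sets:
  assumes "locally_finite_on_pos \<mu>"
  shows "sets \<mu> = sets (restrict_space borel {0<..})" "space \<mu> = {0<..}"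
proof -
  show 1: "sets \<mu> = sets (restrict_space borel {0<..})"
    using assms by (simp add: locally_finite_on_pos_def)
  show "space \<mu> = {0<..}"
    using sets_eq_imp_space_eq[OF 1] by (simp add: space_restrict_space)
qed

lemma in_sets_locally_finite_on_pos:
  assumes "locally_finite_on_pos \<mu>" "A \<in> sets borel" "A \<subseteq> {0<..}"
  shows "A \<in> sets \<mu>"
  using assms by (simp add: locally_finite_on_pos_sets sets_restrict_space_iff)

lemma emeasure_interval_finite:
  assumes "locally_finite_on_pos \<mu>" "0 < a"
  shows "emeasure \<mu> {a..b} < \<infinity>"
  using assms unfolding locally_finite_on_pos_def by (auto simp: subset_eq)

text \<open>The compact intervals from \<open>1 / (n + 1)\<close> to \<open>n + 1\<close> exhaust
  the positive half-line.\<close>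

lemma sigma_finite_locally_finite_on_pos:
  assumes "locally_finite_on_pos \<mu>"
  shows "sigma_finite_measure \<mu>"
proof
  let ?A = "range (\<lambda>n. {1 / real (Suc n) .. real (Suc n)})"
  have "\<Union>?A = {0<..}"
  proof (intro equalityI subsetI)
    fix x :: real assume "x \<in> {0<..}"
    then have x: "x > 0" by simp
    obtain m where m: "1 / real (Suc m) < x" using nat_approx_posE[OF x] by blast
    obtain n where n: "x < real n" using reals_Archimedean2 by blast
    have "1 / real (Suc (max m n)) \<le> 1 / real (Suc m)" by (intro divide_left_mono) auto
    then have "x \<in> {1 / real (Suc (max m n)) .. real (Suc (max m n))}"
      using m n by auto
    then show "x \<in> \<Union>?A" by blast
  next
    fix x assume "x \<in> \<Union>?A"
    then obtain n where "1 / real (Suc n) \<le> x" by auto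
    then show "x \<in> {0<..}" using less_le_trans[of 0 "1 / real (Suc n)" x] by simp
  qed
  moreover have "?A \<subseteq> sets \<mu>"
    using \<open>\<Union>?A = {0<..}\<close> by (auto intro!: in_sets_locally_finite_on_pos[OF assms])
  moreover have "\<forall>a\<in>?A. emeasure \<mu> a \<noteq> \<infinity>"
    using emeasure_interval_finite[OF assms] by (auto simp del: of_nat_Suc) (metis less_irrefl of_nat_0_less_iff zero_less_Suc zero_less_divide_1_iff)
  ultimately show "\<exists>A. countable A \<and> A \<subseteq> sets \<mu> \<and> \<Union>A = space \<mu> \<and> (\<forall>a\<in>A. emeasure \<mu> a \<noteq> \<infinity>)"
    using locally_finite_on_pos_sets(2)[OF assms] by (intro exI[of _ ?A]) auto
qed

lemma space_boolean_intensity: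
  assumes "locally_finite_on_pos \<mu>"
  shows "space (boolean_intensity lam \<mu>) = UNIV \<times> {0<..}"
  using locally_finite_on_pos_sets(2)[OF assms]
  by (simp add: boolean_intensity_def space_pair_measure space_scale_measure)

text \<open>The sigma-algebra of \<open>\<mu>\<close> is only the trace of the Borel sets, so the
  identity into the Borel space is shown to be measurable coordinatewise, and \<open>A\<close> is
  its own preimage within the space.\<close>

lemma in_sets_boolean_intensity:
  fixes A :: "('a::euclidean_space \<times> real) set"
  assumes lf: "locally_finite_on_pos \<mu>" and A: "A \<in> sets borel" "A \<subseteq> UNIV \<times> {0<..}"
  shows "A \<in> sets (boolean_intensity lam \<mu>)"
proof -
  let ?\<nu> = "boolean_intensity lam \<mu> :: ('a \<times> real) measure"
  have "(\<lambda>x. x) \<in> measurable \<mu> (borel :: real measure)"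
    by (subst measurable_cong_sets[OF locally_finite_on_pos_sets(1)[OF lf] refl])
       (intro measurable_restrict_space1 measurable_ident_sets refl)
  then have "snd \<in> measurable ?\<nu> (borel :: real measure)"
    unfolding boolean_intensity_def by (rule measurable_compose[OF measurable_snd])
  moreover have "fst \<in> measurable ?\<nu> (borel :: 'a measure)"
    unfolding boolean_intensity_def
    by (rule measurable_compose[OF measurable_fst]) (simp add: measurable_def space_scale_measure)
  ultimately have "(\<lambda>p. (fst p, snd p)) \<in> measurable ?\<nu> (borel \<Otimes>\<^sub>M borel)"
    by (intro measurable_Pair)
  then have "(\<lambda>p. p) \<in> measurable ?\<nu> borel"
    by (simp add: borel_prod)
  from measurable_sets[OF this A(1)] show ?thesis
    using A(2) by (simp add: space_boolean_intensity[OF lf] Int_absorb2)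
qed

locale boolean_model = poisson_process M \<xi> "boolean_intensity lam \<mu>"
  for M :: "'w measure" and \<xi> :: "'w \<Rightarrow> ('a::euclidean_space \<times> real) set"
    and lam :: real and \<mu> :: "real measure" +
  assumes lam_pos: "lam > 0" and locally_finite: "locally_finite_on_pos \<mu>"
begin

abbreviation \<nu> :: "('a \<times> real) measure" where
  "\<nu> \<equiv> boolean_intensity lam \<mu>"

lemmas in_sets = in_sets_boolean_intensity[OF locally_finite]

lemma radius_pos: "\<omega> \<in> space M \<Longrightarrow> p \<in> \<xi> \<omega> \<Longrightarrow> snd p > 0"
  using points_in_space[of \<omega>]
  by (auto simp: subset_eq mem_Times_iff space_boolean_intensity[OF locally_finite])

text \<open>Since the adjacency relation is open, a step of a chain can be witnessed by two basic open
  sets, whence only countably many hitting events matter.\<close>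

lemma cluster_hit_in_void_algebra:
  fixes D :: "('a \<times> real) set"
  assumes D: "D \<in> sets borel" "D \<subseteq> UNIV \<times> {0<..}" and U: "open U" and V: "open V"
  shows "{\<omega> \<in> space M. cluster (\<xi> \<omega> \<inter> D) U \<inter> V \<noteq> {}} \<in> void_algebra D"
proof -
  interpret V: sigma_algebra "space M" "void_algebra D"
    by (rule sigma_algebra_void_algebra)
  obtain B :: "('a \<times> real) set set" where B: "countable B" "topological_basis B"
    using ex_countable_basis by blast
  have hit: "{\<omega> \<in> space M. \<xi> \<omega> \<inter> (D \<inter> W) \<noteq> {}} \<in> void_algebra D" if "open W" for W
    using that D by (intro hit_in_void_algebra in_sets) auto
  \<comment> \<open>The target \<open>W\<close> has to vary in the induction on the chain length:
    splitting off the last step replaces it by a basic open set \<open>b1\<close>.\<close>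
  have steps: "{\<omega> \<in> space M. (link (\<xi> \<omega> \<inter> D) ^^ n) `` (\<xi> \<omega> \<inter> D \<inter> U) \<inter> W \<noteq> {}} \<in> void_algebra D"
    if "open W" for n W
    using that
  proof (induction n arbitrary: W)
    case 0
    have "{\<omega> \<in> space M. (link (\<xi> \<omega> \<inter> D) ^^ 0) `` (\<xi> \<omega> \<inter> D \<inter> U) \<inter> W \<noteq> {}} =
        {\<omega> \<in> space M. \<xi> \<omega> \<inter> (D \<inter> (U \<inter> W)) \<noteq> {}}"
      by auto
    then show ?case using hit[of "U \<inter> W"] U 0 by (auto simp: open_Int)
  next
    case (Suc n)
    define BB where "BB = {(b1, b2). b1 \<in> B \<and> b2 \<in> B \<and> b2 \<subseteq> W \<and> b1 \<times> b2 \<subseteq> {(p, q). adj p q}}"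
    define Z where "Z \<omega> = (link (\<xi> \<omega> \<inter> D) ^^ n) `` (\<xi> \<omega> \<inter> D \<inter> U)" for \<omega>
    have openB: "open b" if "b \<in> B" for b using B(2) that by (rule topological_basis_open)
    have ZD: "Z \<omega> \<subseteq> \<xi> \<omega> \<inter> D" for \<omega>
      unfolding Z_def by (cases n) (auto simp: link_def)
    have "((link (\<xi> \<omega> \<inter> D) ^^ Suc n) `` (\<xi> \<omega> \<inter> D \<inter> U) \<inter> W \<noteq> {}) \<longleftrightarrow>
        (\<exists>(b1, b2)\<in>BB. Z \<omega> \<inter> b1 \<noteq> {} \<and> \<xi> \<omega> \<inter> (D \<inter> b2) \<noteq> {})" (is "?L \<longleftrightarrow> ?R") for \<omega>
    proof
      assume ?L
      then obtain p q where p: "p \<in> Z \<omega>" and q: "(p, q) \<in> link (\<xi> \<omega> \<inter> D)" "q \<in> W"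
        unfolding Z_def relpow.simps(2) relcomp_Image by blast
      then have pq: "(p, q) \<in> {(p, q). adj p q}" "q \<in> \<xi> \<omega>" "q \<in> D" by (auto simp: link_def)
      obtain A1 A2 where A: "open A1" "open A2" "(p, q) \<in> A1 \<times> A2" "A1 \<times> A2 \<subseteq> {(p, q). adj p q}"
        using open_prod_elim[OF open_adj pq(1)] by metis
      obtain b1 where b1: "b1 \<in> B" "p \<in> b1" "b1 \<subseteq> A1"
        using topological_basisE[OF B(2) A(1), of p] A(3) by auto
      obtain b2 where b2: "b2 \<in> B" "q \<in> b2" "b2 \<subseteq> A2 \<inter> W"
        using topological_basisE[OF B(2) open_Int[OF A(2) Suc.prems], of q] A(3) q(2) by auto
      have "(b1, b2) \<in> BB" using b1 b2 A(4) unfolding BB_def by blast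
      then show ?R using p b1 b2 pq by blast
    next
      assume ?R
      then obtain b1 b2 p q where b: "(b1, b2) \<in> BB" and p: "p \<in> Z \<omega>" "p \<in> b1"
        and q: "q \<in> \<xi> \<omega>" "q \<in> D" "q \<in> b2" by blast
      have "adj p q" "q \<in> W" using b p q by (auto simp: BB_def)
      then have "(p, q) \<in> link (\<xi> \<omega> \<inter> D)" using ZD p q by (auto simp: link_def)
      then show ?L using p(1) \<open>q \<in> W\<close> by (auto simp: Z_def)
    qed
    then have eq: "{\<omega> \<in> space M. (link (\<xi> \<omega> \<inter> D) ^^ Suc n) `` (\<xi> \<omega> \<inter> D \<inter> U) \<inter> W \<noteq> {}} =
        (\<Union>(b1, b2)\<in>BB. {\<omega> \<in> space M. Z \<omega> \<inter> b1 \<noteq> {}} \<inter> {\<omega> \<in> space M. \<xi> \<omega> \<inter> (D \<inter> b2) \<noteq> {}})"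
      by auto
    have "countable BB"
      by (rule countable_subset[of _ "B \<times> B"]) (auto simp: BB_def B)
    then show ?case
      unfolding eq
    proof (intro V.countable_UN'')
      fix b assume "b \<in> BB"
      then obtain b1 b2 where b: "b = (b1, b2)" "open b1" "open b2"
        by (auto simp: BB_def openB)
      show "(case b of (b1, b2) \<Rightarrow> {\<omega> \<in> space M. Z \<omega> \<inter> b1 \<noteq> {}} \<inter> {\<omega> \<in> space M. \<xi> \<omega> \<inter> (D \<inter> b2) \<noteq> {}})
          \<in> void_algebra D"
        using hit[OF b(3)] Suc.IH[OF b(2)] by (auto simp: b(1) Z_def)
    qed
  qed
  have "{\<omega> \<in> space M. cluster (\<xi> \<omega> \<inter> D) U \<inter> V \<noteq> {}} =
      (\<Union>n. {\<omega> \<in> space M. (link (\<xi> \<omega> \<inter> D) ^^ n) `` (\<xi> \<omega> \<inter> D \<inter> U) \<inter> V \<noteq> {}})"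
    unfolding cluster_eq_UN_relpow by blast
  then show ?thesis using steps[OF V] by auto
qed

end

section \<open>Percolation and moments of the radius\<close>

lemma ball_Int_ball_nonempty:
  fixes a b :: "'a::real_normed_vector"
  assumes "dist a b < r + s" "0 < r" "0 < s"
  shows "ball a r \<inter> ball b s \<noteq> {}"
proof -
  \<comment> \<open>The common point divides the segment from \<open>a\<close> to \<open>b\<close>
    in the ratio of the radii.\<close>
  define t where "t = r / (r + s)"
  define z where "z = a + t *\<^sub>R (b - a)"
  have t: "0 < t" "t < 1" "1 - t = s / (r + s)"
    using assms by (auto simp: t_def field_simps)
  have "dist a z = t * dist a b"
    using t by (simp add: z_def dist_norm norm_minus_commute)
  also have "\<dots> < t * (r + s)"
    using assms t by (intro mult_strict_left_mono)
  also have "\<dots> = r" using assms by (simp add: t_def)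
  finally have 1: "dist a z < r" .
  have "b - z = (1 - t) *\<^sub>R (b - a)"
    by (simp add: z_def algebra_simps)
  then have "dist b z = (1 - t) * dist a b"
    using t(1,2) by (simp add: dist_norm norm_minus_commute)
  also have "\<dots> < (1 - t) * (r + s)"
    using assms t by (intro mult_strict_left_mono) auto
  also have "\<dots> = s" using assms by (simp add: t(3))
  finally show ?thesis using 1 by auto
qed

lemma mem_covered_set: "z \<in> covered_set X \<longleftrightarrow> (\<exists>p\<in>X. dist (fst p) z < snd p)"
  by (auto simp: covered_set_def case_prod_beta)

lemma ball_subset_covered_set: "p \<in> X \<Longrightarrow> ball (fst p) (snd p) \<subseteq> covered_set X"
  by (auto simp: mem_covered_set)

lemma covered_set_subset_iff: "covered_set X \<subseteq> A \<longleftrightarrow> (\<forall>p\<in>X. ball (fst p) (snd p) \<subseteq> A)"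
  by (simp add: covered_set_def case_prod_beta UN_subset_iff)

lemma open_covered_set: "open (covered_set X)"
  by (auto simp: covered_set_def)

text \<open>Balls inside the cluster and balls outside it cover two disjoint open sets, so the
  component cannot leave the first one. Conversely, adjacent balls overlap, so induction along
  chains keeps every ball of the cluster in the component.\<close>

lemma component_covered_set:
  fixes X :: "('a::euclidean_space \<times> real) set"
  assumes pos: "\<And>p. p \<in> X \<Longrightarrow> snd p > 0"
  shows "connected_component_set (covered_set X) x = covered_set (cluster X {p. dist (fst p) x < snd p})"
proof -
  let ?K = "cluster X {p. dist (fst p) x < snd p}"
  let ?A = "covered_set ?K" and ?B = "covered_set (X - ?K)"
  have union: "covered_set X = ?A \<union> ?B"
    using cluster_subset[of X] by (auto simp: covered_set_def)
  have disj: "?A \<inter> ?B = {}"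
  proof (rule ccontr)
    assume "?A \<inter> ?B \<noteq> {}"
    then obtain p q z where p: "p \<in> ?K" "dist (fst p) z < snd p"
      and q: "q \<in> X" "q \<notin> ?K" "dist (fst q) z < snd q"
      by (auto simp: mem_covered_set simp del: split_paired_Ex)
    have "dist (fst p) (fst q) \<le> dist (fst p) z + dist (fst q) z"
      by (metis dist_commute dist_triangle)
    then have "adj p q" using p(2) q(3) by (simp add: adj_def)
    then have "q \<in> ?K"
      by (rule cluster_step[OF p(1) subsetD[OF cluster_subset p(1)] q(1)])
    then show False using q(2) by simp
  qed
  have balls: "ball (fst p) (snd p) \<subseteq> connected_component_set ?A x" if "p \<in> ?K" for p
    using that
  proof (induction rule: cluster_induct)
    case (base p)
    then have "p \<in> ?K" by (rule cluster_base)
    then have "ball (fst p) (snd p) \<subseteq> ?A" by (rule ball_subset_covered_set)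
    then show ?case
      using base by (intro connected_component_maximal) auto
  next
    case (step p q)
    then have qK: "q \<in> ?K" by (blast intro: cluster_step)
    then have sub: "ball (fst q) (snd q) \<subseteq> ?A" by (rule ball_subset_covered_set)
    obtain z where z: "z \<in> ball (fst p) (snd p)" "z \<in> ball (fst q) (snd q)"
      using ball_Int_ball_nonempty[of "fst p" "fst q" "snd p" "snd q"] step pos
      by (auto simp: adj_def)
    then have "z \<in> connected_component_set ?A x" using step by auto
    then have "connected_component_set ?A z = connected_component_set ?A x"
      using connected_component_eq by metis
    moreover have "ball (fst q) (snd q) \<subseteq> connected_component_set ?A z"
      using z sub by (intro connected_component_maximal) auto
    ultimately show ?case by simp
  qed
  show ?thesis
  proof (cases "x \<in> ?A")
    case True
    have "?A \<subseteq> connected_component_set ?A x"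
      using balls by (simp add: covered_set_subset_iff)
    also have "\<dots> \<subseteq> connected_component_set (covered_set X) x"
      using union by (intro connected_component_mono) auto
    finally have 1: "?A \<subseteq> connected_component_set (covered_set X) x" .
    let ?C = "connected_component_set (covered_set X) x"
    have "?C \<subseteq> ?A \<union> ?B" using union connected_component_subset by metis
    moreover have "?A \<inter> ?C \<noteq> {}" using True 1 by auto
    ultimately have "?B \<inter> ?C = {}"
      using connectedD[OF connected_connected_component[of "covered_set X" x] open_covered_set[of ?K] open_covered_set[of "X - ?K"]]
        disj by blast
    then have "?C \<subseteq> ?A" using \<open>?C \<subseteq> ?A \<union> ?B\<close> by blast
    with 1 show ?thesis by auto
  next
    \<comment> \<open>A ball of \<open>X\<close> containing \<open>x\<close> would itself start the
      cluster. So no ball contains \<open>x\<close>, and both sides are empty.\<close>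
    case False
    have "x \<notin> covered_set X"
    proof
      assume "x \<in> covered_set X"
      then obtain p where "p \<in> X" "dist (fst p) x < snd p"
        unfolding mem_covered_set by blast
      then have "p \<in> ?K" by (intro cluster_base) auto
      with \<open>dist (fst p) x < snd p\<close> False show False
        unfolding mem_covered_set by blast
    qed
    moreover have "?K = {}"
    proof (rule ccontr)
      assume "?K \<noteq> {}"
      then obtain q where "q \<in> ?K" by auto
      then obtain p where "p \<in> X" "dist (fst p) x < snd p"
        by (induction rule: cluster_induct) auto
      then show False using \<open>x \<notin> covered_set X\<close> unfolding mem_covered_set by blast
    qed
    ultimately show ?thesis
      using connected_component_eq_empty[of "covered_set X" x] by (simp add: covered_set_def[of "{}"])
  qed
qed

text \<open>A ball lies in the closed ball of radius \<open>n\<close> around 0 exactly if the norm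
  of its centre plus its radius is at most \<open>n\<close>. Percolation thus becomes a countable
  intersection of hitting events for clusters, with open start and target conditions, which is what
  measurability requires.\<close>

lemma percolates_iff:
  fixes X :: "('a::euclidean_space \<times> real) set"
  assumes pos: "\<And>p. p \<in> X \<Longrightarrow> snd p > 0"
  shows "percolates X \<longleftrightarrow>
    (\<forall>n::nat. cluster X {p. norm (fst p) < snd p} \<inter> {p. norm (fst p) + snd p > real n} \<noteq> {})"
proof -
  let ?K = "cluster X {p. norm (fst p) < snd p}"
  have "bounded (covered_set ?K) \<longleftrightarrow> (\<exists>n::nat. covered_set ?K \<subseteq> cball 0 (real n))"
  proof
    assume "bounded (covered_set ?K)"
    then obtain b where "covered_set ?K \<subseteq> cball 0 b"
      by (metis bounded_iff mem_cball_0 subsetI)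
    moreover obtain n where "b \<le> real n" using real_arch_simple by blast
    ultimately show "\<exists>n::nat. covered_set ?K \<subseteq> cball 0 (real n)"
      by (meson order_trans subset_cball)
  qed (auto intro: bounded_subset)
  also have "\<dots> \<longleftrightarrow> (\<exists>n::nat. \<forall>p\<in>?K. norm (fst p) + snd p \<le> real n)"
  proof -
    have "covered_set ?K \<subseteq> cball 0 (real n) \<longleftrightarrow> (\<forall>p\<in>?K. ball (fst p) (snd p) \<subseteq> cball 0 (real n))" for n
      by (rule covered_set_subset_iff)
    moreover have "ball (fst p) (snd p) \<subseteq> cball 0 (real n) \<longleftrightarrow> norm (fst p) + snd p \<le> real n" if "p \<in> ?K" for p n
      using pos[OF subsetD[OF cluster_subset that]] by (auto simp: ball_subset_cball_iff)
    ultimately show ?thesis by simp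
  qed
  finally have "percolates X \<longleftrightarrow> \<not> (\<exists>n::nat. \<forall>p\<in>?K. norm (fst p) + snd p \<le> real n)"
    using component_covered_set[OF pos, where x = 0] by (simp add: percolates_def)
  then show ?thesis by (simp add: disjoint_iff Bex_def not_le del: split_paired_Ex split_paired_All)
qed

lemma open_meet: "open {p :: 'a::real_normed_vector \<times> real. norm (fst p - x) < snd p + L}"
  by (intro open_Collect_less continuous_intros)

lemma open_exit: "open {p :: 'a::real_normed_vector \<times> real. norm (fst p - x) + snd p > L}"
  by (intro open_Collect_less continuous_intros)

text \<open>The single inequality makes the ball contain the origin and reach beyond distance
  \<open>n\<close>, so a chain of one ball suffices for each \<open>n\<close>.\<close>

lemma percolates_if_large_balls:
  assumes "\<And>p. p \<in> X \<Longrightarrow> snd p > 0"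
    and "\<And>n::nat. \<exists>p\<in>X. norm (fst p) + real n < snd p"
  shows "percolates X"
proof -
  have "cluster X {p. norm (fst p) < snd p} \<inter> {p. norm (fst p) + snd p > real n} \<noteq> {}" for n :: nat
  proof -
  obtain p where p: "p \<in> X" "norm (fst p) + real n < snd p" using assms(2) by blast
  then have "p \<in> cluster X {p. norm (fst p) < snd p}" by (intro cluster_base) auto
  with p(2) show "cluster X {p. norm (fst p) < snd p} \<inter> {p. norm (fst p) + snd p > real n} \<noteq> {}"
    using norm_ge_zero[of "fst p"] by (intro ex_in_conv[THEN iffD1] exI[of _ p] IntI CollectI) linarith+
  qed
  then show ?thesis using percolates_iff[of X] assms(1) by blast
qed

lemma sigma_finite_scale_lborel: "sigma_finite_measure (scale_measure (ennreal c) lborel)"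
proof
  obtain A :: "'a set set" where A: "countable A" "A \<subseteq> sets lborel" "\<Union>A = space lborel"
      "\<And>a. a \<in> A \<Longrightarrow> emeasure lborel a \<noteq> \<infinity>"
    using lborel.sigma_finite_countable by metis
  then show "\<exists>A::'a set set. countable A \<and> A \<subseteq> sets (scale_measure (ennreal c) lborel) \<and>
      \<Union>A = space (scale_measure (ennreal c) lborel) \<and> (\<forall>a\<in>A. emeasure (scale_measure (ennreal c) lborel) a \<noteq> \<infinity>)"
    by (intro exI[of _ A]) (auto simp: space_scale_measure ennreal_mult_eq_top_iff)
qed

lemma emeasure_boolean_intensity:
  fixes A :: "('a::euclidean_space \<times> real) set"
  assumes lf: "locally_finite_on_pos \<mu>" and A: "A \<in> sets borel" "A \<subseteq> UNIV \<times> {0<..}"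
  shows "emeasure (boolean_intensity lam \<mu>) A = ennreal lam * (\<integral>\<^sup>+r. emeasure lborel {c. (c, r) \<in> A} \<partial>\<mu>)"
proof -
  interpret N: sigma_finite_measure \<mu> by (rule sigma_finite_locally_finite_on_pos[OF lf])
  interpret L: sigma_finite_measure "scale_measure (ennreal lam) (lborel :: 'a measure)"
    by (rule sigma_finite_scale_lborel)
  interpret pair_sigma_finite "scale_measure (ennreal lam) (lborel :: 'a measure)" \<mu> ..
  have A': "A \<in> sets (scale_measure (ennreal lam) lborel \<Otimes>\<^sub>M \<mu>)"
    using in_sets_boolean_intensity[OF lf A, of lam] unfolding boolean_intensity_def .
  have "emeasure (boolean_intensity lam \<mu>) A =
      (\<integral>\<^sup>+r. ennreal lam * emeasure lborel ((\<lambda>x. (x, r)) -` A) \<partial>\<mu>)"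
    unfolding boolean_intensity_def by (simp add: emeasure_pair_measure_alt2[OF A'])
  also have "\<dots> = ennreal lam * (\<integral>\<^sup>+r. emeasure lborel ((\<lambda>x. (x, r)) -` A) \<partial>\<mu>)"
  proof (rule nn_integral_cmult)
    interpret Q: pair_sigma_finite "lborel :: 'a measure" \<mu> ..
    have "sets (scale_measure (ennreal lam) (lborel :: 'a measure) \<Otimes>\<^sub>M \<mu>) = sets (lborel \<Otimes>\<^sub>M \<mu>)"
      by (intro sets_pair_measure_cong sets_scale_measure refl)
    with A' have "A \<in> sets (lborel \<Otimes>\<^sub>M \<mu>)" by blast
    then show "(\<lambda>r. emeasure lborel ((\<lambda>x. (x, r)) -` A)) \<in> borel_measurable \<mu>"
      by (rule Q.measurable_emeasure_Pair2)
  qed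
  finally show ?thesis by (simp add: vimage_def)
qed

lemma emeasure_lborel_ball:
  assumes "0 \<le> r"
  shows "emeasure lborel (ball (x::'a::euclidean_space) r) = ennreal (unit_ball_vol (DIM('a)) * r ^ DIM('a))"
  using emeasure_ball[OF assms, of x] by (simp add: emeasure_completion)

section \<open>Tail moments of the radius\<close>

text \<open>The integral of (A2) with a variable lower limit; its decay in \<open>s\<close> is what
  (A2) contributes to the renormalization.\<close>

definition moment :: "nat \<Rightarrow> real measure \<Rightarrow> real \<Rightarrow> ennreal" where
  "moment d \<mu> s = (\<integral>\<^sup>+\<beta>\<in>{s..}. ennreal (\<beta> ^ d) \<partial>\<mu>)"

lemma A2_iff: "A2 d \<mu> \<longleftrightarrow> moment d \<mu> 1 < \<infinity>"
  by (simp add: A2_def moment_def)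

lemma borel_measurable_pos [measurable]:
  fixes f :: "real \<Rightarrow> 'b::topological_space"
  assumes lf: "locally_finite_on_pos \<mu>" and f: "f \<in> borel_measurable borel"
  shows "f \<in> borel_measurable \<mu>"
  by (subst measurable_cong_sets[OF locally_finite_on_pos_sets(1)[OF lf] refl])
    (intro measurable_restrict_space1 f)

lemma moment_eq_emeasure_density:
  assumes lf: "locally_finite_on_pos \<mu>" and "0 < s"
  shows "moment d \<mu> s = emeasure (density \<mu> (\<lambda>\<beta>. ennreal (\<beta> ^ d))) {s..}"
  unfolding moment_def using assms
  by (subst emeasure_density)
    (auto intro!: borel_measurable_pos[OF lf] in_sets_locally_finite_on_pos[OF lf])

text \<open>Markov's inequality; it bounds the error term of the recursion by a tail moment.\<close>

lemma emeasure_tail_le_moment: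
  assumes lf: "locally_finite_on_pos \<mu>" and "0 < s"
  shows "ennreal (s ^ d) * emeasure \<mu> {s..} \<le> moment d \<mu> s"
proof -
  have "ennreal (s ^ d) * emeasure \<mu> {s..} = (\<integral>\<^sup>+\<beta>. ennreal (s ^ d) * indicator {s..} \<beta> \<partial>\<mu>)"
    using assms by (subst nn_integral_cmult_indicator) (auto intro!: in_sets_locally_finite_on_pos[OF lf])
  also have "\<dots> \<le> moment d \<mu> s"
    unfolding moment_def using assms
    by (intro nn_integral_mono) (auto split: split_indicator intro!: ennreal_leI power_mono)
  finally show ?thesis .
qed

text \<open>On \<open>{1..s}\<close> the integrand is at most \<open>s ^ d\<close>, and this compact
  interval has finite measure by local finiteness. For \<open>s < 1\<close> the interval is
  empty.\<close>

lemma moment_finite_if_tail_finite: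
  assumes lf: "locally_finite_on_pos \<mu>" and fin: "moment d \<mu> s < \<infinity>"
  shows "moment d \<mu> 1 < \<infinity>"
proof -
  have "moment d \<mu> 1 \<le> (\<integral>\<^sup>+\<beta>. ennreal (s ^ d) * indicator {1..s} \<beta> + ennreal (\<beta> ^ d) * indicator {s..} \<beta> \<partial>\<mu>)"
    unfolding moment_def
    by (intro nn_integral_mono) (auto split: split_indicator intro!: ennreal_leI power_mono)
  also have "\<dots> = ennreal (s ^ d) * emeasure \<mu> {1..s} + moment d \<mu> s"
    unfolding moment_def
    by (subst nn_integral_add)
      (auto intro!: borel_measurable_pos[OF lf] nn_integral_cmult_indicator in_sets_locally_finite_on_pos[OF lf]
        arg_cong2[where f = "(+)"])
  also have "\<dots> < \<infinity>"
    using fin emeasure_interval_finite[OF lf, of 1 s] by (auto simp: ennreal_mult_less_top)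
  finally show ?thesis .
qed

text \<open>Continuity from above of the measure with density \<open>\<beta> ^ d\<close>, along
  half-lines that decrease to the empty set.\<close>

lemma moment_tendsto_0:
  assumes lf: "locally_finite_on_pos \<mu>" and fin: "moment d \<mu> 1 < \<infinity>"
    and r: "incseq r" "\<And>n. 1 \<le> r n" "filterlim r at_top sequentially"
  shows "(\<lambda>n. moment d \<mu> (r n)) \<longlonglongrightarrow> 0"
proof -
  let ?K = "density \<mu> (\<lambda>\<beta>. ennreal (\<beta> ^ d))"
  have pos: "0 < r n" for n using r(2)[of n] by simp
  have mono: "moment d \<mu> (r n) \<le> moment d \<mu> 1" for n
    unfolding moment_def using r(2)[of n] by (intro nn_integral_mono) (auto split: split_indicator)
  have "(\<lambda>n. emeasure ?K {r n..}) \<longlonglongrightarrow> emeasure ?K (\<Inter>n. {r n..})"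
  proof (rule Lim_emeasure_decseq)
    show "range (\<lambda>n. {r n..}) \<subseteq> sets ?K"
      using less_le_trans[OF pos] by (auto intro!: in_sets_locally_finite_on_pos[OF lf])
    show "decseq (\<lambda>n. {r n..})"
      using r(1) by (auto simp: decseq_def incseq_def intro: order_trans)
    show "emeasure ?K {r n..} \<noteq> \<infinity>" for n
      using mono[of n] fin by (auto simp: moment_eq_emeasure_density[OF lf pos])
  qed
  moreover have "(\<Inter>n. {r n..}) = {}"
  proof (rule ccontr)
    assume "(\<Inter>n. {r n..}) \<noteq> {}"
    then obtain x where x: "r n \<le> x" for n by auto
    obtain n where "r n > x"
      using r(3) by (metis eventually_happens filterlim_at_top_dense trivial_limit_sequentially)
    then show False using x[of n] by simp
  qed
  ultimately show ?thesis by (simp add: moment_eq_emeasure_density[OF lf pos])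
qed

section \<open>The percolation event and the necessity of (A2)\<close>

context boolean_model
begin

lemma boolean_process_eq: "\<omega> \<in> space M \<Longrightarrow> \<xi> \<omega> \<inter> UNIV \<times> {0<..} = \<xi> \<omega>"
  using radius_pos by (auto simp: mem_Times_iff)

lemma percolation_event: "{\<omega> \<in> space M. percolates (\<xi> \<omega>)} \<in> events"
proof -
  have hit: "{\<omega> \<in> space M.
      cluster (\<xi> \<omega> \<inter> UNIV \<times> {0<..}) {p. norm (fst p) < snd p} \<inter> {p. norm (fst p) + snd p > real n} \<noteq> {}}
      \<in> events" for n
  proof (rule subsetD[OF void_algebra_subset_events cluster_hit_in_void_algebra])
    show "UNIV \<times> {0<..} \<in> sets (borel :: ('a \<times> real) measure)"
      by (intro borel_open open_Times) auto
    show "open {p :: 'a \<times> real. norm (fst p) < snd p}" "open {p :: 'a \<times> real. norm (fst p) + snd p > real n}"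
      using open_meet[of "0::'a" 0] open_exit[of "real n" "0::'a"] by simp_all
  qed simp
  have "{\<omega> \<in> space M. percolates (\<xi> \<omega>)} = (\<Inter>n::nat. {\<omega> \<in> space M.
      cluster (\<xi> \<omega> \<inter> UNIV \<times> {0<..}) {p. norm (fst p) < snd p} \<inter> {p. norm (fst p) + snd p > real n} \<noteq> {}})"
    using radius_pos by (auto simp: percolates_iff boolean_process_eq cong: conj_cong)
  also have "\<dots> \<in> events"
    using hit by (intro sets.countable_INT') auto
  finally show ?thesis .
qed

text \<open>For large \<open>r\<close> the admissible centres fill a ball of radius at least
  \<open>r / 2\<close>, so the intensity is bounded below by a positive multiple of a tail moment of
  order \<open>d\<close>, which is infinite if (A2) fails.\<close>

lemma large_balls_infinite:
  assumes "\<not> A2 (DIM('a)) \<mu>"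
  shows "emeasure \<nu> {(c, r). 0 < r \<and> norm c + real n < r} = \<infinity>"
proof -
  let ?d = "DIM('a)" and ?A = "{(c::'a, r). 0 < r \<and> norm c + real n < r}"
  let ?v = "unit_ball_vol ?d"
  \<comment> \<open>For \<open>r \<ge> s\<close> this gives
    \<open>r - n \<ge> r / 2\<close>.\<close>
  define s where "s = 2 * real n + 1"
  have "open ?A"
    unfolding case_prod_unfold by (intro open_Collect_conj open_Collect_less continuous_intros)
  then have A: "?A \<in> sets borel" by simp
  have "emeasure \<nu> ?A = ennreal lam * (\<integral>\<^sup>+r. emeasure lborel {c. (c, r) \<in> ?A} \<partial>\<mu>)"
    by (rule emeasure_boolean_intensity[OF locally_finite A]) auto
  moreover have "ennreal (?v * (1 / 2) ^ ?d) * moment ?d \<mu> s \<le> (\<integral>\<^sup>+r. emeasure lborel {c. (c, r) \<in> ?A} \<partial>\<mu>)"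
  proof -
    have "ennreal (?v * (1 / 2) ^ ?d) * moment ?d \<mu> s =
        (\<integral>\<^sup>+r. ennreal (?v * (1 / 2) ^ ?d) * (ennreal (r ^ ?d) * indicator {s..} r) \<partial>\<mu>)"
      unfolding moment_def
      by (intro nn_integral_cmult[symmetric] borel_measurable_pos[OF locally_finite]) auto
    also have "\<dots> \<le> (\<integral>\<^sup>+r. emeasure lborel {c. (c, r) \<in> ?A} \<partial>\<mu>)"
    proof (intro nn_integral_mono)
      fix r
      show "ennreal (?v * (1 / 2) ^ ?d) * (ennreal (r ^ ?d) * indicator {s..} r)
          \<le> emeasure lborel {c. (c, r) \<in> ?A}"
      proof (cases "s \<le> r")
        case True
        then have r: "r > 0" "r / 2 \<le> r - real n" by (auto simp: s_def)
        have "{c. (c, r) \<in> ?A} = ball 0 (r - real n)" using r by auto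
        moreover have "(r / 2) ^ ?d \<le> (r - real n) ^ ?d" using r by (intro power_mono) auto
        ultimately show ?thesis
          using r True by (auto simp: emeasure_lborel_ball ennreal_mult[symmetric] power_divide
              intro!: ennreal_leI) (auto simp: field_simps intro!: mult_left_mono)
      qed auto
    qed
    finally show ?thesis .
  qed
  moreover have "moment ?d \<mu> s = \<infinity>"
    using moment_finite_if_tail_finite[OF locally_finite, of ?d s] assms
    by (cases "moment ?d \<mu> s < \<infinity>") (auto simp: A2_iff less_top[symmetric])
  ultimately show ?thesis
    using lam_pos unit_ball_vol_pos[of "real ?d", THEN less_imp_neq]
    by (auto simp: ennreal_mult_eq_top_iff top_unique ennreal_mult_top)
qed

text \<open>Almost surely, for every \<open>n\<close> one ball of the process covers the ball of
  radius \<open>n\<close> around 0. If percolation were null, the whole space would be a countable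
  union of null sets.\<close>

lemma percolation_not_null:
  assumes "\<not> A2 (DIM('a)) \<mu>"
  shows "{\<omega> \<in> space M. percolates (\<xi> \<omega>)} \<notin> null_sets M"
proof
  let ?A = "\<lambda>n::nat. {(c::'a, r). 0 < r \<and> norm c + real n < r}"
  assume null: "{\<omega> \<in> space M. percolates (\<xi> \<omega>)} \<in> null_sets M"
  have "open (?A n)" for n
    unfolding case_prod_unfold by (intro open_Collect_conj open_Collect_less continuous_intros)
  then have A: "?A n \<in> sets \<nu>" for n by (intro in_sets) auto
  have "void (?A n) \<in> null_sets M" for n
    using prob_void_infinite[OF A large_balls_infinite[OF assms]] void_in_events[OF A]
    by (auto simp: null_sets_def emeasure_eq_measure)
  then have "{\<omega> \<in> space M. percolates (\<xi> \<omega>)} \<union> (\<Union>n. void (?A n)) \<in> null_sets M"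
    using null by (intro null_sets.Un null_sets_UN) auto
  moreover have "space M \<subseteq> {\<omega> \<in> space M. percolates (\<xi> \<omega>)} \<union> (\<Union>n. void (?A n))"
  proof
    fix \<omega> assume \<omega>: "\<omega> \<in> space M"
    show "\<omega> \<in> {\<omega> \<in> space M. percolates (\<xi> \<omega>)} \<union> (\<Union>n. void (?A n))"
    proof (cases "\<exists>n. \<omega> \<in> void (?A n)")
      case False
      have "percolates (\<xi> \<omega>)"
      proof (rule percolates_if_large_balls)
        show "\<exists>p\<in>\<xi> \<omega>. norm (fst p) + real n < snd p" for n :: nat
          using False \<omega> by (force simp: void_def)
      qed (use radius_pos[OF \<omega>] in auto)
      then show ?thesis using \<omega> by simp
    qed auto
  qed
  ultimately have "space M \<in> null_sets M"
    by (intro null_sets_subset[of _ M "space M"]) auto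
  then show False
    using emeasure_space_1 by auto
qed

end

section \<open>Renormalization\<close>

text \<open>For positive radii and \<open>L > 0\<close>: the balls that intersect
  \<open>ball x L\<close>.\<close>

definition meet :: "'a::real_normed_vector \<Rightarrow> real \<Rightarrow> ('a \<times> real) set" where
  "meet x L = {p. norm (fst p - x) < snd p + L}"

text \<open>For positive radii: the balls that are not contained in
  \<open>cball x L\<close>.\<close>

definition exit :: "'a::real_normed_vector \<Rightarrow> real \<Rightarrow> ('a \<times> real) set" where
  "exit x L = {p. norm (fst p - x) + snd p > L}"

text \<open>A ball of radius at most \<open>L\<close> that touches \<open>ball x (2 * L)\<close> has
  its centre within \<open>3 * L\<close> of \<open>x\<close>. The intersection with
  \<open>{0<..}\<close> keeps the region among positive radii when the cutoff \<open>e\<close> is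
  0.\<close>

definition region :: "real \<Rightarrow> 'a::real_normed_vector \<Rightarrow> real \<Rightarrow> ('a \<times> real) set" where
  "region e x L = ball x (3 * L) \<times> ({e..L} \<inter> {0<..})"

text \<open>Chains are confined to the region, so that the event depends on the process there only
  and distant crossings are independent.\<close>

definition crossing :: "real \<Rightarrow> 'a::real_normed_vector \<Rightarrow> real \<Rightarrow> ('a \<times> real) set \<Rightarrow> bool" where
  "crossing e x L X \<longleftrightarrow> cluster (X \<inter> region e x L) (meet x L) \<inter> exit x (2 * L) \<noteq> {}"

lemma adj_norm_less:
  fixes x :: "'a::real_normed_vector"
  assumes "adj p q"
  shows "norm (fst q - x) < norm (fst p - x) + snd p + snd q"
proof -
  have "norm (fst q - x) \<le> norm (fst p - x) + norm (fst p - fst q)"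
    using dist_triangle[of "fst q" x "fst p"] by (simp add: dist_norm norm_minus_commute)
  then show ?thesis using assms by (simp add: adj_def dist_norm)
qed

text \<open>As long as a chain has not left \<open>cball x (2 * L)\<close>, its next ball meets the
  ball of radius \<open>2 * L\<close>. By \<open>large\<close> this ball has radius at most
  \<open>L\<close>, hence its centre is within \<open>3 * L\<close> and it lies in the region. So
  without an exit inside the region the whole cluster stays there.\<close>

lemma crossing_if_exit:
  fixes X :: "('a::real_normed_vector \<times> real) set"
  assumes pos: "\<And>p. p \<in> X \<Longrightarrow> snd p > 0" and low: "\<And>p. p \<in> X \<Longrightarrow> e \<le> snd p"
    and large: "\<And>p. p \<in> X \<Longrightarrow> snd p > L \<Longrightarrow> norm (fst p - x) \<ge> 2 * L + snd p"
    and L: "L > 0" and ex: "cluster X (meet x L) \<inter> exit x (2 * L) \<noteq> {}"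
  shows "crossing e x L X"
proof (rule ccontr)
  assume no: "\<not> crossing e x L X"
  have "p \<in> cluster (X \<inter> region e x L) (meet x L)" if "p \<in> cluster X (meet x L)" for p
    using that
  proof (induction rule: cluster_induct)
    case (base p)
    have n: "norm (fst p - x) < snd p + L" using base by (simp add: meet_def)
    have "snd p \<le> L" using large[OF base(1)] n L by force
    then have "p \<in> region e x L"
      using n L pos[OF base(1)] low[OF base(1)]
      by (auto simp: region_def mem_Times_iff dist_norm norm_minus_commute)
    then show ?case using base by (auto intro: cluster_base)
  next
    case (step p q)
    note pK = \<open>p \<in> cluster (X \<inter> region e x L) (meet x L)\<close>
    have "p \<notin> exit x (2 * L)" using pK no by (auto simp: crossing_def)
    then have p: "norm (fst p - x) + snd p \<le> 2 * L" by (simp add: exit_def)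
    have n: "norm (fst q - x) < 2 * L + snd q"
      using adj_norm_less[OF \<open>adj p q\<close>, of x] p by simp
    have "snd q \<le> L" using large[OF \<open>q \<in> X\<close>] n L by force
    then have "q \<in> region e x L"
      using n L pos[OF \<open>q \<in> X\<close>] low[OF \<open>q \<in> X\<close>]
      by (auto simp: region_def mem_Times_iff dist_norm norm_minus_commute)
    then have "q \<in> X \<inter> region e x L" using \<open>q \<in> X\<close> by simp
    then show ?case
      by (rule cluster_step[OF pK subsetD[OF cluster_subset pK] _ \<open>adj p q\<close>])
  qed
  then show False using ex no by (auto simp: crossing_def)
qed

text \<open>Balls of radius at most \<open>L\<close> cannot jump over the sphere of radius
  \<open>\<rho> * L\<close>. Some ball of the chain has its centre near this sphere, and a net point
  \<open>f\<close> places it close to \<open>z = x + L *\<^sub>R f\<close>. Followed backwards, the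
  chain leads from there to a start near \<open>x\<close>, far away from \<open>z\<close>, which is
  a crossing around \<open>z\<close>.\<close>

lemma crossing_descends_radius:
  fixes x :: "'a::real_normed_vector"
  assumes L: "L > 0" and net: "\<And>y::'a. norm y \<le> 50 \<Longrightarrow> \<exists>f\<in>F. norm (y - f) < 1"
    and cr: "crossing e x (24 * L) X"
    and small: "\<And>p. p \<in> X \<Longrightarrow> p \<in> region e x (24 * L) \<Longrightarrow> snd p \<le> L"
    and \<rho>: "30 \<le> \<rho>" "\<rho> \<le> 42"
  obtains f where "f \<in> F" "\<rho> - 2 \<le> norm f" "norm f \<le> \<rho> + 2" "crossing e (x + L *\<^sub>R f) L X"
proof -
  define Y where "Y = X \<inter> region e x (24 * L)"
  have Y: "snd p \<le> L" "snd p > 0" "e \<le> snd p" if "p \<in> Y" for p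
    using that small by (auto simp: Y_def region_def)
  let ?K = "cluster Y (meet x (24 * L))"
  have inY: "p \<in> Y" if "p \<in> ?K" for p using that cluster_subset by blast
  have "\<exists>p\<in>?K. norm (fst p - x) + snd p > \<rho> * L \<and> norm (fst p - x) \<le> \<rho> * L + L"
  proof (rule ccontr)
    \<comment> \<open>Otherwise no chain passes the sphere: the successor of a ball inside has its
      centre within \<open>\<rho> * L + L\<close>, so by assumption it is inside as well.\<close>
    assume no: "\<not> ?thesis"
    have \<rho>L: "30 * L \<le> \<rho> * L" "\<rho> * L \<le> 42 * L"
      using \<rho> L by (auto intro!: mult_right_mono)
    have bound: "norm (fst p - x) + snd p \<le> \<rho> * L" if "p \<in> ?K" for p
      using that
    proof (induction rule: cluster_induct)
      case (base p)
      then have "norm (fst p - x) < snd p + 24 * L" by (simp add: meet_def)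
      then show ?case using Y(1)[OF base(1)] \<rho>L(1) L by linarith
    next
      case (step p q)
      then have "q \<in> ?K" by (blast intro: cluster_step)
      moreover have "norm (fst q - x) \<le> \<rho> * L + L"
        using adj_norm_less[OF \<open>adj p q\<close>, of x] step Y(1)[of q] by simp
      ultimately show ?case using no by force
    qed
    have "norm (fst p - x) + snd p \<le> 2 * (24 * L)" if "p \<in> ?K" for p
      using bound[OF that] \<rho>L(2) L by linarith
    then have "?K \<inter> exit x (2 * (24 * L)) = {}"
      by (auto simp: exit_def disjoint_iff not_less)
    then show False using cr by (simp add: crossing_def Y_def)
  qed
  then obtain p where p: "p \<in> ?K" "norm (fst p - x) + snd p > \<rho> * L" "norm (fst p - x) \<le> \<rho> * L + L"
    by blast
  define y where "y = (1 / L) *\<^sub>R (fst p - x)"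
  have ny: "norm y = norm (fst p - x) / L" using L by (simp add: y_def)
  have "norm y \<le> \<rho> + 1" using p(3) L by (simp add: ny field_simps)
  moreover have "\<rho> - 1 \<le> norm y" using p(2) Y(1)[OF inY[OF p(1)]] L by (simp add: ny field_simps)
  moreover from calculation obtain f where f: "f \<in> F" "norm (y - f) < 1" using net[of y] \<rho> by auto
  ultimately have nf: "\<rho> - 2 \<le> norm f" "norm f \<le> \<rho> + 2"
    using norm_triangle_ineq2[of y f] norm_triangle_ineq2[of f y] by (auto simp: norm_minus_commute)
  define z where "z = x + L *\<^sub>R f"
  have "fst p - z = L *\<^sub>R (y - f)" using L by (simp add: y_def z_def algebra_simps)
  then have "norm (fst p - z) < L" using f L by simp
  then have "p \<in> meet z L" using Y(2)[OF inY[OF p(1)]] by (simp add: meet_def)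
  then obtain s where s: "s \<in> cluster Y (meet z L)" "s \<in> meet x (24 * L)"
    using cluster_sym[OF p(1)] by blast
  have sY: "s \<in> Y" using s cluster_subset by blast
  \<comment> \<open>The point \<open>z\<close> is at distance at least \<open>28 * L\<close> from
    \<open>x\<close> and the centre of \<open>s\<close> at less than \<open>25 * L\<close>, so
    \<open>s\<close> is more than \<open>3 * L\<close> away from \<open>z\<close>.\<close>
  have "norm (L *\<^sub>R f) \<le> norm (fst s - z) + norm (fst s - x)"
    using norm_triangle_ineq4[of "fst s - x" "fst s - z"] by (simp add: z_def)
  moreover have "28 * L \<le> norm (L *\<^sub>R f)" using nf \<rho> L by (simp add: mult.commute)
  moreover have "norm (fst s - x) < 25 * L" using s(2) Y(1)[OF sY] by (simp add: meet_def)
  ultimately have "2 * L < norm (fst s - z) + snd s" using Y(2)[OF sY] L by linarith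
  then have "s \<in> exit z (2 * L)" by (simp add: exit_def)
  then have "cluster Y (meet z L) \<inter> exit z (2 * L) \<noteq> {}" using s by blast
  then have "crossing e z L Y"
    using Y L by (intro crossing_if_exit) (auto simp: not_less[symmetric])
  then have "crossing e z L X"
    using cluster_mono[of "Y \<inter> region e z L" "X \<inter> region e z L" "meet z L" "meet z L"]
    by (auto simp: crossing_def Y_def)
  then show ?thesis using that[OF f(1) nf] by (simp add: z_def)
qed

text \<open>The spheres 30 and 42 yield net points of norm at most 32 and at least 40. The
  separation 6 is what makes two regions with base radius \<open>3 * L\<close> disjoint.\<close>

lemma crossing_descends:
  fixes x :: "'a::real_normed_vector"
  assumes L: "L > 0" and net: "\<And>y::'a. norm y \<le> 50 \<Longrightarrow> \<exists>f\<in>F. norm (y - f) < 1"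
    and cr: "crossing e x (24 * L) X"
    and small: "\<And>p. p \<in> X \<Longrightarrow> p \<in> region e x (24 * L) \<Longrightarrow> snd p \<le> L"
  obtains f g where "f \<in> F" "g \<in> F" "6 \<le> norm (f - g)"
    "crossing e (x + L *\<^sub>R f) L X" "crossing e (x + L *\<^sub>R g) L X"
proof -
  obtain f where f: "f \<in> F" "norm f \<le> 30 + 2" "crossing e (x + L *\<^sub>R f) L X"
    using crossing_descends_radius[OF L net cr small, of 30] by force
  obtain g where g: "g \<in> F" "42 - 2 \<le> norm g" "crossing e (x + L *\<^sub>R g) L X"
    using crossing_descends_radius[OF L net cr small, of 42] by force
  have "6 \<le> norm (f - g)"
    using norm_triangle_ineq2[of g f] f g by (simp add: norm_minus_commute)
  then show ?thesis using that f g by blast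
qed

lemma regions_disjoint:
  fixes f g :: "'a::real_normed_vector"
  assumes "L > 0" "6 \<le> norm (f - g)"
  shows "region e (x + L *\<^sub>R f) L \<inter> region e (x + L *\<^sub>R g) L = {}"
proof -
  have "6 * L \<le> norm (L *\<^sub>R (f - g))" using assms by (simp add: mult.commute)
  also have "\<dots> = dist (x + L *\<^sub>R f) (x + L *\<^sub>R g)" by (simp add: dist_norm algebra_simps)
  finally have "ball (x + L *\<^sub>R f) (3 * L) \<inter> ball (x + L *\<^sub>R g) (3 * L) = {}"
    by (intro disjoint_ballI) simp
  then show ?thesis by (auto simp: region_def)
qed

lemma region_borel: "region e (x::'a::euclidean_space) L \<in> sets borel"
  unfolding region_def by (intro borel_Times) auto

lemma open_meet_exit: "open (meet x L)" "open (exit x L)"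
  using open_meet[of x L] open_exit[of L x] by (auto simp: meet_def exit_def)

section \<open>Recursion for the crossing probability\<close>

context boolean_model
begin

definition crossing_event :: "real \<Rightarrow> 'a \<Rightarrow> real \<Rightarrow> 'w set" where
  "crossing_event e x L = {\<omega> \<in> space M. crossing e x L (\<xi> \<omega>)}"

lemma crossing_event_in_void_algebra: "crossing_event e x L \<in> void_algebra (region e x L)"
  unfolding crossing_event_def crossing_def
  by (intro cluster_hit_in_void_algebra region_borel open_meet_exit) (auto simp: region_def)

lemma crossing_event_in_events [measurable]: "crossing_event e x L \<in> events"
  using crossing_event_in_void_algebra void_algebra_subset_events by blast

text \<open>These are the balls that violate \<open>small\<close> in
  \<open>crossing_descends\<close>; \<open>72 = 3 * 24\<close> comes from the region at scale
  \<open>24 * L\<close>. Enlarging the range of radii to \<open>{L..}\<close> produces the quantity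
  of (A1).\<close>

lemma emeasure_annulus_le:
  assumes "L > 0"
  shows "emeasure \<nu> (ball x (72 * L) \<times> {L<..24 * L}) \<le>
    ennreal (lam * unit_ball_vol (DIM('a)) * 72 ^ DIM('a)) * (ennreal (L ^ DIM('a)) * emeasure \<mu> {L..})"
proof -
  let ?d = "DIM('a)" and ?A = "ball x (72 * L) \<times> {L<..24 * L}"
  let ?v = "unit_ball_vol ?d"
  have A: "?A \<in> sets borel" by (intro borel_Times) auto
  have "emeasure \<nu> ?A = ennreal lam * (\<integral>\<^sup>+r. emeasure lborel {c. (c, r) \<in> ?A} \<partial>\<mu>)"
    using assms by (intro emeasure_boolean_intensity[OF locally_finite A]) auto
  also have "(\<integral>\<^sup>+r. emeasure lborel {c. (c, r) \<in> ?A} \<partial>\<mu>) \<le>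
      (\<integral>\<^sup>+r. ennreal (?v * (72 * L) ^ ?d) * indicator {L..} r \<partial>\<mu>)"
  proof (intro nn_integral_mono)
    fix r
    have "emeasure lborel {c. (c, r) \<in> ?A} \<le> emeasure lborel (ball x (72 * L))"
      by (intro emeasure_mono) auto
    then show "emeasure lborel {c. (c, r) \<in> ?A} \<le> ennreal (?v * (72 * L) ^ ?d) * indicator {L..} r"
      using assms by (auto split: split_indicator simp: emeasure_lborel_ball)
  qed
  also have "\<dots> = ennreal (?v * (72 * L) ^ ?d) * emeasure \<mu> {L..}"
    using assms by (intro nn_integral_cmult_indicator in_sets_locally_finite_on_pos[OF locally_finite]) auto
  finally show ?thesis
    using assms lam_pos
    by (simp add: power_mult_distrib ennreal_mult' mult.assoc mult_left_mono)
qed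

text \<open>The centres allowed for radius \<open>r\<close> have volume proportional to
  \<open>(3 * r) ^ d\<close>, so integrating over \<open>r\<close> gives a tail moment. The factor
  is raised from 3 to 72 so that the constant agrees with that of
  \<open>emeasure_annulus_le\<close>.\<close>

lemma emeasure_large_balls_le:
  assumes "L > 0"
  shows "emeasure \<nu> {(c, r). L < r \<and> norm c < 3 * r} \<le>
    ennreal (lam * unit_ball_vol (DIM('a)) * 72 ^ DIM('a)) * moment DIM('a) \<mu> L"
proof -
  let ?d = "DIM('a)" and ?A = "{(c::'a, r). L < r \<and> norm c < 3 * r}"
  let ?v = "unit_ball_vol ?d"
  have "open ?A"
    unfolding case_prod_unfold by (intro open_Collect_conj open_Collect_less continuous_intros)
  then have A: "?A \<in> sets borel" by simp
  have "emeasure \<nu> ?A = ennreal lam * (\<integral>\<^sup>+r. emeasure lborel {c. (c, r) \<in> ?A} \<partial>\<mu>)"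
    using assms by (intro emeasure_boolean_intensity[OF locally_finite A]) auto
  also have "(\<integral>\<^sup>+r. emeasure lborel {c. (c, r) \<in> ?A} \<partial>\<mu>) \<le>
      (\<integral>\<^sup>+r. ennreal (?v * 72 ^ ?d) * (ennreal (r ^ ?d) * indicator {L..} r) \<partial>\<mu>)"
  proof (intro nn_integral_mono)
    fix r
    show "emeasure lborel {c. (c, r) \<in> ?A} \<le> ennreal (?v * 72 ^ ?d) * (ennreal (r ^ ?d) * indicator {L..} r)"
    proof (cases "L < r")
      case True
      then have "{c. (c, r) \<in> ?A} = ball 0 (3 * r)" by auto
      moreover have "(3 * r) ^ ?d \<le> (72 * r) ^ ?d" using True assms by (intro power_mono) auto
      ultimately show ?thesis
        using True assms
        by (auto simp: emeasure_lborel_ball ennreal_mult[symmetric] power_mult_distrib mult.assoc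
            intro!: ennreal_leI mult_left_mono)
    qed auto
  qed
  also have "\<dots> = ennreal (?v * 72 ^ ?d) * moment ?d \<mu> L"
    unfolding moment_def
    by (intro nn_integral_cmult borel_measurable_pos[OF locally_finite]) auto
  finally show ?thesis
    using assms lam_pos
    by (simp add: ennreal_mult' mult.assoc mult_left_mono)
qed

text \<open>Union bound over the pairs of separated net points, each contributing two independent
  crossings, plus the expected number \<open>h\<close> of balls too large for the descent.\<close>

lemma prob_crossing_descends:
  assumes L: "L > 0" and F: "finite F" and net: "\<And>y::'a. norm y \<le> 50 \<Longrightarrow> \<exists>f\<in>F. norm (y - f) < 1"
    and q: "\<And>x. prob (crossing_event e x L) \<le> q"
    and tail: "ennreal (lam * unit_ball_vol (DIM('a)) * 72 ^ DIM('a)) * (ennreal (L ^ DIM('a)) * emeasure \<mu> {L..})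
      \<le> ennreal h" and h: "0 \<le> h"
  shows "prob (crossing_event e x (24 * L)) \<le> (real (card F))\<^sup>2 * q\<^sup>2 + h"
proof -
  define H where "H = ball x (72 * L) \<times> {L<..24 * L}"
  define C where "C f = crossing_event e (x + L *\<^sub>R f) L" for f
  define J where "J = {(f, g) \<in> F \<times> F. 6 \<le> norm (f - g)}"
  have H: "H \<in> sets \<nu>" unfolding H_def using L by (intro in_sets borel_Times) auto
  have C: "C f \<in> events" for f by (simp add: C_def)
  have J: "finite J" by (rule finite_subset[of _ "F \<times> F"]) (auto simp: J_def F)
  have "crossing_event e x (24 * L) \<subseteq> (\<Union>j\<in>J. C (fst j) \<inter> C (snd j)) \<union> (space M - void H)"
  proof
    fix \<omega> assume \<omega>: "\<omega> \<in> crossing_event e x (24 * L)"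
    show "\<omega> \<in> (\<Union>j\<in>J. C (fst j) \<inter> C (snd j)) \<union> (space M - void H)"
    proof (cases "\<omega> \<in> void H")
      case True
      have small: "snd p \<le> L" if "p \<in> \<xi> \<omega>" "p \<in> region e x (24 * L)" for p
      proof (rule ccontr)
        assume "\<not> snd p \<le> L"
        then have "p \<in> H" using that by (auto simp: H_def region_def)
        then show False using True that by (auto simp: void_def)
      qed
      have "crossing e x (24 * L) (\<xi> \<omega>)" using \<omega> by (simp add: crossing_event_def)
      from crossing_descends[OF L net this small] obtain f g where "f \<in> F" "g \<in> F" "6 \<le> norm (f - g)"
          "crossing e (x + L *\<^sub>R f) L (\<xi> \<omega>)" "crossing e (x + L *\<^sub>R g) L (\<xi> \<omega>)"
        by metis
      then have "(f, g) \<in> J" "\<omega> \<in> C f \<inter> C g" using \<omega> by (auto simp: J_def C_def crossing_event_def)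
      then show ?thesis by force
    qed (use \<omega> in \<open>auto simp: crossing_event_def\<close>)
  qed
  then have "prob (crossing_event e x (24 * L)) \<le> prob ((\<Union>j\<in>J. C (fst j) \<inter> C (snd j)) \<union> (space M - void H))"
    using H J C by (intro finite_measure_mono sets.Un sets.finite_UN sets.Int sets.compl_sets) auto
  also have "\<dots> \<le> prob (\<Union>j\<in>J. C (fst j) \<inter> C (snd j)) + prob (space M - void H)"
    using H J C by (intro measure_Un_le sets.Un sets.finite_UN sets.Int sets.compl_sets) auto
  also have "prob (\<Union>j\<in>J. C (fst j) \<inter> C (snd j)) \<le> (\<Sum>j\<in>J. prob (C (fst j) \<inter> C (snd j)))"
    using J by (intro finite_measure_subadditive_finite) (auto simp: C_def)
  also have "\<dots> \<le> (\<Sum>j\<in>J. q\<^sup>2)"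
  proof (intro sum_mono)
    fix j assume "j \<in> J"
    then obtain f g where j: "j = (f, g)" "6 \<le> norm (f - g)" by (auto simp: J_def)
    have "prob (C f \<inter> C g) = prob (C f) * prob (C g)"
      unfolding C_def
      by (intro prob_Int_void_algebra[OF regions_disjoint[OF L j(2), of e x]] crossing_event_in_void_algebra)
    also have "\<dots> \<le> q\<^sup>2"
      unfolding power2_eq_square C_def using q order_trans[OF measure_nonneg q]
      by (intro mult_mono) auto
    finally show "prob (C (fst j) \<inter> C (snd j)) \<le> q\<^sup>2"
      by (simp add: j)
  qed
  also have "\<dots> \<le> (real (card F))\<^sup>2 * q\<^sup>2"
  proof -
    have "card J \<le> card (F \<times> F)" using F by (intro card_mono) (auto simp: J_def)
    then have "real (card J) \<le> (real (card F))\<^sup>2"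
      by (metis card_cartesian_product of_nat_mono of_nat_mult power2_eq_square)
    then show ?thesis by (simp add: mult_right_mono)
  qed
  also have "prob (space M - void H) \<le> h"
  proof -
    have le: "emeasure \<nu> H \<le> ennreal h"
      using order_trans[OF emeasure_annulus_le[OF L] tail] by (simp add: H_def)
    then have fin: "emeasure \<nu> H < \<infinity>" by (auto intro: le_less_trans)
    have "measure \<nu> H \<le> h"
      using le h by (simp add: measure_def enn2real_leI)
    then show ?thesis using prob_hit_le[OF H fin] by simp
  qed
  finally show ?thesis by simp
qed

text \<open>Every positive radius exceeds some \<open>1 / real (Suc k)\<close>, and a finite chain
  needs only one such cutoff.\<close>

lemma crossing_event_eq_UN:
  "crossing_event 0 x L = (\<Union>k. crossing_event (1 / real (Suc k)) x L)" (is "_ = (\<Union>k. ?C k)")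
  "incseq (\<lambda>k. crossing_event (1 / real (Suc k)) x L)"
proof -
  have inc: "incseq (\<lambda>k. X \<inter> region (1 / real (Suc k)) x L)" for X
  proof (rule incseq_SucI)
    fix k
    have "1 / real (Suc (Suc k)) \<le> 1 / real (Suc k)" by (intro divide_left_mono) auto
    then show "X \<inter> region (1 / real (Suc k)) x L \<subseteq> X \<inter> region (1 / real (Suc (Suc k))) x L"
      by (auto simp: region_def)
  qed
  have eq: "X \<inter> region 0 x L = (\<Union>k. X \<inter> region (1 / real (Suc k)) x L)" for X
  proof -
    have "\<exists>k. 1 / real (Suc k) \<le> r" if "0 < r" for r :: real
      using nat_approx_posE[OF that] by (metis less_imp_le)
    then show ?thesis by (force simp: region_def)
  qed
  show "crossing_event 0 x L = (\<Union>k. ?C k)"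
    unfolding crossing_event_def crossing_def eq cluster_UN[OF inc] by auto
  show "incseq ?C"
    unfolding crossing_event_def crossing_def using cluster_mono[OF incseqD[OF inc] order_refl]
    by (fastforce simp: incseq_def)
qed

text \<open>The bound \<open>\<eta>\<close> reproduces itself under the recursion: the quadratic
  term and the error term are each at most \<open>\<eta> / 2\<close>. It holds trivially at scales
  below the cutoff \<open>e\<close>, hence at all scales, and continuity from below then yields
  \<open>e = 0\<close>.\<close>

lemma crossing_event_bound:
  assumes F: "finite F" and net: "\<And>y::'a. norm y \<le> 50 \<Longrightarrow> \<exists>f\<in>F. norm (y - f) < 1"
    and tail: "\<And>L. L > 0 \<Longrightarrow> ennreal (lam * unit_ball_vol (DIM('a)) * 72 ^ DIM('a)) *
      (ennreal (L ^ DIM('a)) * emeasure \<mu> {L..}) \<le> ennreal (\<eta> / 2)"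
    and \<eta>: "0 \<le> \<eta>" "(real (card F))\<^sup>2 * \<eta> \<le> 1 / 2" and L: "L > 0"
  shows "prob (crossing_event 0 x L) \<le> \<eta>"
proof -
  \<comment> \<open>Here \<open>n\<close> bounds the number of scales between \<open>e\<close> and
    \<open>L\<close>. For \<open>n = 0\<close> no radius is admissible and the region is
    empty.\<close>
  have trunc: "prob (crossing_event e x L) \<le> \<eta>" if "0 < L" "L < 24 ^ n * e" for e x L n
    using that
  proof (induction n arbitrary: L x)
    case 0
    then have "region e x L = {}" by (auto simp: region_def)
    then have "crossing_event e x L = {}"
      using cluster_subset[of "{}"] by (auto simp: crossing_event_def crossing_def)
    then show ?case using \<eta> by simp
  next
    case (Suc n)
    have "prob (crossing_event e x (24 * (L / 24))) \<le> (real (card F))\<^sup>2 * \<eta>\<^sup>2 + \<eta> / 2"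
      using Suc.prems \<eta> by (intro prob_crossing_descends[OF _ F net Suc.IH tail]) auto
    moreover have "(real (card F))\<^sup>2 * \<eta>\<^sup>2 \<le> \<eta> / 2"
      using mult_right_mono[OF \<eta>(2,1)] by (simp add: power2_eq_square mult.assoc)
    ultimately show ?case by simp
  qed
  have "(\<lambda>k. prob (crossing_event (1 / real (Suc k)) x L)) \<longlonglongrightarrow> prob (crossing_event 0 x L)"
    unfolding crossing_event_eq_UN(1)
    by (intro finite_Lim_measure_incseq crossing_event_eq_UN(2)) auto
  moreover have "prob (crossing_event (1 / real (Suc k)) x L) \<le> \<eta>" for k
  proof -
    obtain n where "L / (1 / real (Suc k)) < 24 ^ n" using real_arch_pow[of 24] by auto
    then have "L < 24 ^ n * (1 / real (Suc k))" by (simp add: field_simps)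
    with L show ?thesis by (rule trunc)
  qed
  ultimately show ?thesis by (intro LIMSEQ_le_const2) auto
qed

text \<open>A ball containing 0 meets \<open>ball 0 L\<close>, and an unbounded cluster exits
  \<open>cball 0 (2 * L)\<close>. If the exceptional set is avoided, \<open>r > L\<close> implies
  \<open>norm c \<ge> 3 * r\<close>, hence \<open>norm c \<ge> 2 * L + r\<close> as
  \<open>crossing_if_exit\<close> requires.\<close>

lemma percolation_subset:
  assumes "L > 0"
  shows "{\<omega> \<in> space M. percolates (\<xi> \<omega>)} \<subseteq>
    crossing_event 0 0 L \<union> (space M - void {(c, r). L < r \<and> norm c < 3 * r})"
proof
  fix \<omega> assume \<omega>: "\<omega> \<in> {\<omega> \<in> space M. percolates (\<xi> \<omega>)}"
  then have pos: "snd p > 0" if "p \<in> \<xi> \<omega>" for p using radius_pos[of \<omega> p] that by simp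
  show "\<omega> \<in> crossing_event 0 0 L \<union> (space M - void {(c, r). L < r \<and> norm c < 3 * r})"
  proof (cases "\<omega> \<in> void {(c, r). L < r \<and> norm c < 3 * r}")
    case True
    have large: "2 * L + snd p \<le> norm (fst p - 0)" if "p \<in> \<xi> \<omega>" "snd p > L" for p
      using True that by (force simp: void_def)
    obtain n where n: "2 * L \<le> real n" using real_arch_simple by blast
    have "cluster (\<xi> \<omega>) {p. norm (fst p) < snd p} \<inter> {p. norm (fst p) + snd p > real n} \<noteq> {}"
      using \<omega> percolates_iff[of "\<xi> \<omega>"] pos by simp
    moreover have "cluster (\<xi> \<omega>) {p. norm (fst p) < snd p} \<subseteq> cluster (\<xi> \<omega>) (meet 0 L)"
      using assms by (intro cluster_mono) (auto simp: meet_def)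
    moreover have "{p. norm (fst p) + snd p > real n} \<subseteq> exit (0::'a) (2 * L)"
      using n by (auto simp: exit_def)
    ultimately have "cluster (\<xi> \<omega>) (meet 0 L) \<inter> exit 0 (2 * L) \<noteq> {}" by blast
    then have "crossing 0 0 L (\<xi> \<omega>)"
      using assms pos by (intro crossing_if_exit large) (auto simp: less_imp_le)
    then show ?thesis using \<omega> by (simp add: crossing_event_def)
  qed (use \<omega> in auto)
qed

lemma percolation_null:
  assumes F: "finite F" "F \<noteq> {}" and net: "\<And>y::'a. norm y \<le> 50 \<Longrightarrow> \<exists>f\<in>F. norm (y - f) < 1"
    and tail: "\<And>L. L > 0 \<Longrightarrow> ennreal (lam * unit_ball_vol (DIM('a)) * 72 ^ DIM('a)) *
      (ennreal (L ^ DIM('a)) * emeasure \<mu> {L..}) \<le> ennreal (\<eta> / 2)"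
    and \<eta>: "0 \<le> \<eta>" "(real (card F))\<^sup>2 * \<eta> \<le> 1 / 2" and A2: "A2 (DIM('a)) \<mu>"
  shows "{\<omega> \<in> space M. percolates (\<xi> \<omega>)} \<in> null_sets M"
proof -
  let ?d = "DIM('a)"
  let ?N = "real (card F)"
  define c where "c = lam * unit_ball_vol ?d * 72 ^ ?d"
  have c: "0 \<le> c" using lam_pos by (simp add: c_def)
  have "prob {\<omega> \<in> space M. percolates (\<xi> \<omega>)} \<le> \<delta>" if "\<delta> > 0" for \<delta>
  proof -
    \<comment> \<open>Two parts go to the crossing probability and one to the large balls.\<close>
    define \<epsilon> where "\<epsilon> = \<delta> / 3"
    have \<epsilon>: "\<epsilon> > 0" using that by (simp add: \<epsilon>_def)
    have "(\<lambda>n. moment ?d \<mu> (24 ^ n)) \<longlonglongrightarrow> 0"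
      using A2
      by (intro moment_tendsto_0[OF locally_finite])
        (auto simp: A2_iff incseq_def power_increasing
          intro!: filterlim_at_infinity_imp_filterlim_at_top filterlim_realpow_sequentially_gt1)
    then have "(\<lambda>n. ennreal c * moment ?d \<mu> (24 ^ n)) \<longlonglongrightarrow> ennreal c * 0"
      by (intro ennreal_tendsto_cmult) auto
    then have "eventually (\<lambda>n. ennreal c * moment ?d \<mu> (24 ^ n) < ennreal (\<epsilon> / 2)) sequentially"
      using \<epsilon> by (intro order_tendstoD(2)) auto
    then obtain m where m: "ennreal c * moment ?d \<mu> (24 ^ n) < ennreal (\<epsilon> / 2)" if "n \<ge> m" for n
      by (auto simp: eventually_sequentially)
    have decay: "prob (crossing_event 0 x (24 ^ (m + k))) \<le> \<eta> / 2 ^ k + \<epsilon>" for k x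
    proof (induction k arbitrary: x)
      case 0
      have "prob (crossing_event 0 x (24 ^ m)) \<le> \<eta>"
        by (rule crossing_event_bound[OF F(1) net tail \<eta>]) auto
      then show ?case using \<epsilon> by simp
    next
      case (Suc k)
      define L :: real where "L = 24 ^ (m + k)"
      \<comment> \<open>In \<open>q\<^sup>2\<close> one factor is bounded by \<open>\<eta>\<close>,
        which absorbs the squared cardinality into 1/2, and the other by the induction hypothesis.
        The recursion then halves \<open>\<eta> / 2 ^ k + \<epsilon>\<close> and adds
        \<open>\<epsilon> / 2\<close>.\<close>
      define q where "q = min \<eta> (\<eta> / 2 ^ k + \<epsilon>)"
      have L: "L > 0" by (simp add: L_def)
      have q: "0 \<le> q" using \<eta> \<epsilon> by (simp add: q_def)
      have "ennreal c * (ennreal (L ^ ?d) * emeasure \<mu> {L..}) \<le> ennreal (\<epsilon> / 2)"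
        using order_trans[OF mult_left_mono[OF emeasure_tail_le_moment[OF locally_finite L, of ?d]] less_imp_le[OF m, of "m + k", folded L_def]]
        by simp
      moreover have "prob (crossing_event 0 x L) \<le> q" for x
        using crossing_event_bound[OF F(1) net tail \<eta> L] Suc.IH by (simp add: q_def L_def)
      ultimately have "prob (crossing_event 0 x (24 * L)) \<le> ?N\<^sup>2 * q\<^sup>2 + \<epsilon> / 2"
        using \<epsilon> by (intro prob_crossing_descends[OF L F(1) net]) (auto simp: c_def)
      also have "?N\<^sup>2 * q\<^sup>2 \<le> ?N\<^sup>2 * (\<eta> * (\<eta> / 2 ^ k + \<epsilon>))"
        unfolding power2_eq_square[of q] using q \<eta> \<epsilon> by (intro mult_left_mono mult_mono) (auto simp: q_def)
      also have "\<dots> \<le> (1 / 2) * (\<eta> / 2 ^ k + \<epsilon>)"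
        unfolding mult.assoc[symmetric] using \<eta> \<epsilon> by (intro mult_right_mono) auto
      finally show ?case by (simp add: L_def add_divide_distrib mult.commute)
    qed
    have "(\<lambda>k. \<eta> / 2 ^ k) \<longlonglongrightarrow> 0"
      using tendsto_mult_right_zero[OF LIMSEQ_inverse_realpow_zero[of 2], of \<eta>] by (simp add: divide_inverse)
    then have "eventually (\<lambda>k. \<eta> / 2 ^ k < \<epsilon>) sequentially"
      using \<epsilon> by (intro order_tendstoD(2))
    then obtain k where k: "\<eta> / 2 ^ k < \<epsilon>" by (auto simp: eventually_sequentially)
    define L :: real where "L = 24 ^ (m + k)"
    have L: "L > 0" by (simp add: L_def)
    let ?T = "{(c::'a, r). L < r \<and> norm c < 3 * r}"
    have "open ?T"
      unfolding case_prod_unfold by (intro open_Collect_conj open_Collect_less continuous_intros)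
    then have T: "?T \<in> sets \<nu>" using L by (intro in_sets) auto
    have Tle: "emeasure \<nu> ?T \<le> ennreal (\<epsilon> / 2)"
      using order_trans[OF emeasure_large_balls_le[OF L] less_imp_le[OF m[unfolded c_def], of "m + k", folded L_def]]
      by simp
    then have Tfin: "emeasure \<nu> ?T < \<infinity>" by (rule le_less_trans) simp
    have "measure \<nu> ?T \<le> \<epsilon> / 2"
      unfolding measure_def using Tle \<epsilon> by (intro enn2real_leI) auto
    then have "prob (space M - void ?T) \<le> \<epsilon>"
      using prob_hit_le[OF T Tfin] \<epsilon> by simp
    moreover have "prob {\<omega> \<in> space M. percolates (\<xi> \<omega>)} \<le> prob (crossing_event 0 0 L) + prob (space M - void ?T)"
      using T by (intro order_trans[OF finite_measure_mono[OF percolation_subset[OF L]] measure_Un_le]) auto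
    moreover have "prob (crossing_event 0 0 L) \<le> 2 * \<epsilon>"
      using decay[of 0 k] k by (simp add: L_def)
    ultimately show ?thesis by (simp add: \<epsilon>_def)
  qed
  then have "prob {\<omega> \<in> space M. percolates (\<xi> \<omega>)} \<le> 0"
    using field_le_epsilon[of "prob {\<omega> \<in> space M. percolates (\<xi> \<omega>)}" 0] by simp
  then have "prob {\<omega> \<in> space M. percolates (\<xi> \<omega>)} = 0"
    by (rule antisym) simp
  then show ?thesis
    using percolation_event by (intro null_setsI) (simp_all add: emeasure_eq_measure)
qed

end

lemma subcritical_if_A1_A2:
  fixes \<mu> :: "real measure" and \<xi> :: "real \<Rightarrow> 'w \<Rightarrow> ('a::euclidean_space \<times> real) set"
  assumes lf: "locally_finite_on_pos \<mu>"
    and ppp: "\<And>lam. lam > 0 \<Longrightarrow> poisson_point_process (P lam) (\<xi> lam) (boolean_intensity lam \<mu>)"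
    and A1: "A1 (DIM('a)) \<mu>" and A2: "A2 (DIM('a)) \<mu>"
  shows "has_subcritical_regime P \<xi>"
proof -
  let ?d = "DIM('a)"
  obtain K where K: "0 \<le> K" "\<And>r. r > 0 \<Longrightarrow> ennreal (r ^ ?d) * emeasure \<mu> {r..} \<le> ennreal K"
  proof (cases "SUP r\<in>{0<..}. ennreal (r ^ ?d) * emeasure \<mu> {r..}")
    case (real K)
    then show ?thesis
      using that[of K] SUP_upper[of _ "{0<..}" "\<lambda>r. ennreal (r ^ ?d) * emeasure \<mu> {r..}"] by auto
  next
    case top
    then show ?thesis
      using A1 by (simp only: A1_def less_irrefl infinity_ennreal_def)
  qed
  have cover: "cball (0::'a) 50 \<subseteq> (\<Union>f\<in>UNIV. ball f 1)"
  proof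
    fix y :: 'a
    show "y \<in> (\<Union>f\<in>UNIV. ball f 1)" by (rule UN_I[of y]) auto
  qed
  obtain F where F: "finite F" "cball (0::'a) 50 \<subseteq> (\<Union>f\<in>F. ball f 1)"
    using compactE_image[OF compact_cball _ cover] by (metis open_ball)
  have net: "\<exists>f\<in>F. norm (y - f) < 1" if "norm y \<le> 50" for y
  proof -
    have "y \<in> (\<Union>f\<in>F. ball f 1)" using F(2) that by (rule subsetD[OF _ mem_cball_0[THEN iffD2]])
    then show ?thesis by (auto simp: dist_norm norm_minus_commute)
  qed
  have "F \<noteq> {}" using net[of 0] by auto
  then have N: "0 < real (card F)" using F(1) by (simp add: card_gt_0_iff)
  \<comment> \<open>The largest value for which the recursion preserves the bound
    \<open>\<eta>\<close>.\<close>
  define \<eta> where "\<eta> = 1 / (2 * (real (card F))\<^sup>2)"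
  have \<eta>: "0 < \<eta>" "(real (card F))\<^sup>2 * \<eta> \<le> 1 / 2" using N by (auto simp: \<eta>_def)
  define v where "v = unit_ball_vol ?d * 72 ^ ?d"
  have v: "v > 0" by (simp add: v_def)
  \<comment> \<open>Below this intensity the error term is at most \<open>\<eta> / 2\<close> at
    every scale; \<open>K + 1\<close> keeps the denominator positive for
    \<open>K = 0\<close>.\<close>
  define lam0 where "lam0 = \<eta> / (2 * (v * (K + 1)))"
  have lam0: "lam0 > 0" using \<eta> v K(1) by (simp add: lam0_def)
  have "{\<omega> \<in> space (P lam). percolates (\<xi> lam \<omega>)} \<in> null_sets (P lam)" if lam: "lam \<in> {0<..<lam0}" for lam
  proof -
    interpret boolean_model "P lam" "\<xi> lam" lam \<mu>
      using lam ppp lf by unfold_locales auto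
    show ?thesis
    proof (rule percolation_null[OF F(1) \<open>F \<noteq> {}\<close> net])
      fix L :: real assume L: "L > 0"
      have "ennreal (lam * v) * (ennreal (L ^ ?d) * emeasure \<mu> {L..}) \<le> ennreal (lam * v) * ennreal K"
        by (intro mult_left_mono K(2)[OF L]) simp
      also have "\<dots> = ennreal (lam * v * K)" using lam v K by (simp add: ennreal_mult')
      also have "lam * v * K \<le> lam0 * v * (K + 1)" using lam v K by (intro mult_mono) auto
      also have "\<dots> = \<eta> / 2" 
      proof -
        define w where "w = v * (K + 1)"
        have "w > 0" using v K(1) by (simp add: w_def)
        then show ?thesis by (simp add: lam0_def mult.assoc w_def[symmetric])
      qed
      finally show "ennreal (lam * unit_ball_vol ?d * 72 ^ ?d) * (ennreal (L ^ ?d) * emeasure \<mu> {L..}) \<le> ennreal (\<eta> / 2)"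
        by (simp add: v_def mult.assoc ennreal_leI)
    qed (use \<eta> A2 in auto)
  qed
  then show ?thesis
    unfolding has_subcritical_regime_def using lam0 by blast
qed

section \<open>Peierls argument\<close>

definition lattice :: "'a::euclidean_space set" where
  "lattice = {z. \<forall>b\<in>Basis. z \<bullet> b \<in> \<int>}"

text \<open>Closed cubes: neighbours share points, so they connect, and finite unions are
  closed.\<close>

definition cube :: "'a::euclidean_space \<Rightarrow> 'a set" where
  "cube z = cbox z (z + One)"

text \<open>Star-adjacency: displacements between cubes that share at least a corner, including
  0.\<close>

definition steps :: "'a::euclidean_space set" where
  "steps = {s \<in> lattice. \<forall>b\<in>Basis. \<bar>s \<bullet> b\<bar> \<le> 1}"

lemma mem_cube: "y \<in> cube z \<longleftrightarrow> (\<forall>b\<in>Basis. z \<bullet> b \<le> y \<bullet> b \<and> y \<bullet> b \<le> z \<bullet> b + 1)"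
  by (auto simp: cube_def mem_box inner_add_left)

lemma lattice_coordinate:
  assumes "z \<in> lattice" "b \<in> Basis"
  obtains k where "z \<bullet> b = real_of_int k"
proof -
  have "z \<bullet> b \<in> \<int>" using assms by (simp add: lattice_def)
  then show ?thesis using that by (rule Ints_cases)
qed

lemma finite_lattice_bounded: "finite {z \<in> lattice. \<forall>b\<in>Basis. \<bar>(z::'a::euclidean_space) \<bullet> b\<bar> \<le> R}"
proof -
  let ?I = "real_of_int ` {- \<lceil>R\<rceil>..\<lceil>R\<rceil>}"
  let ?P = "(Basis :: 'a set) \<rightarrow>\<^sub>E ?I"
  have "{z \<in> lattice. \<forall>b\<in>Basis. \<bar>(z::'a) \<bullet> b\<bar> \<le> R} \<subseteq> (\<lambda>f. \<Sum>b\<in>Basis. f b *\<^sub>R b) ` ?P"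
  proof
    fix z :: 'a assume z: "z \<in> {z \<in> lattice. \<forall>b\<in>Basis. \<bar>z \<bullet> b\<bar> \<le> R}"
    let ?f = "restrict (\<lambda>b. z \<bullet> b) Basis"
    have "z \<bullet> b \<in> ?I" if b: "b \<in> Basis" for b
    proof -
      obtain k where k: "z \<bullet> b = real_of_int k"
        using z b lattice_coordinate[of z b] by blast
      have "\<bar>real_of_int k\<bar> \<le> R" using z that k by auto
      then have "k \<in> {- \<lceil>R\<rceil>..\<lceil>R\<rceil>}" by (simp add: abs_le_iff) linarith
      then show ?thesis using k by auto
    qed
    then have "?f \<in> ?P" by auto
    then show "z \<in> (\<lambda>f. \<Sum>b\<in>Basis. f b *\<^sub>R b) ` ?P"
      by (rule image_eqI[rotated]) (simp add: euclidean_representation)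
  qed
  moreover have "finite ?P" by (intro finite_PiE) auto
  ultimately show ?thesis by (rule finite_subset[OF _ finite_imageI])
qed

lemma finite_steps: "finite (steps :: 'a::euclidean_space set)"
  unfolding steps_def by (rule finite_lattice_bounded)

lemma zero_in_lattice: "0 \<in> lattice"
  by (simp add: lattice_def)

lemma zero_in_steps: "0 \<in> steps"
  by (simp add: steps_def zero_in_lattice)

lemma finite_cubes_meeting_bounded:
  fixes B :: "'a::euclidean_space set"
  assumes "bounded B"
  shows "finite {z \<in> lattice. cube z \<inter> B \<noteq> {}}"
proof -
  obtain R where R: "norm y \<le> R" if "y \<in> B" for y using assms by (auto simp: bounded_iff)
  have "{z \<in> lattice. cube z \<inter> B \<noteq> {}} \<subseteq> {z \<in> lattice. \<forall>b\<in>Basis. \<bar>z \<bullet> b\<bar> \<le> R + 1}"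
  proof safe
    fix z y b :: 'a assume y: "y \<in> cube z" "y \<in> B" and b: "b \<in> Basis"
    have "\<bar>y \<bullet> b\<bar> \<le> R" using Basis_le_norm[OF b, of y] R[OF y(2)] by simp
    moreover have "z \<bullet> b \<le> y \<bullet> b \<and> y \<bullet> b \<le> z \<bullet> b + 1" using y b by (auto simp: mem_cube)
    ultimately show "\<bar>z \<bullet> b\<bar> \<le> R + 1" by linarith
  qed
  then show ?thesis by (rule finite_subset) (rule finite_lattice_bounded)
qed

lemma cubes_cover: obtains z where "z \<in> lattice" "y \<in> cube (z::'a::euclidean_space)"
proof
  let ?z = "\<Sum>b\<in>Basis. of_int \<lfloor>y \<bullet> b\<rfloor> *\<^sub>R b :: 'a"
  show "?z \<in> lattice" by (auto simp: lattice_def)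
  show "y \<in> cube ?z" by (auto simp: mem_cube) 
qed

lemma diff_in_steps:
  fixes z w :: "'a::euclidean_space"
  assumes "z \<in> lattice" "w \<in> lattice" "cube z \<inter> cube w \<noteq> {}"
  shows "w - z \<in> steps"
proof -
  obtain y where y: "y \<in> cube z" "y \<in> cube w" using assms by blast
  have "\<bar>(w - z) \<bullet> b\<bar> \<le> 1" if "b \<in> Basis" for b
  proof -
    have "z \<bullet> b \<le> y \<bullet> b \<and> y \<bullet> b \<le> z \<bullet> b + 1" "w \<bullet> b \<le> y \<bullet> b \<and> y \<bullet> b \<le> w \<bullet> b + 1"
      using y that by (auto simp: mem_cube)
    then show ?thesis by (simp add: inner_diff_left abs_le_iff)
  qed
  then show ?thesis using assms by (auto simp: steps_def lattice_def inner_diff_left)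
qed

text \<open>A path of minimal length visits no point twice, since the loop in between could be cut
  out.\<close>

lemma rtrancl_simple_path:
  assumes "(x, y) \<in> R\<^sup>*"
  obtains f n where "f 0 = x" "f n = y" "\<And>i. i < n \<Longrightarrow> (f i, f (Suc i)) \<in> R" "inj_on f {..n::nat}"
proof -
  define n where "n = (LEAST n. (x, y) \<in> R ^^ n)"
  have "\<exists>n. (x, y) \<in> R ^^ n" using assms by (simp add: rtrancl_power)
  then have n: "(x, y) \<in> R ^^ n" unfolding n_def by (rule LeastI_ex)
  obtain f where f: "f 0 = x" "f n = y" "\<forall>i<n. (f i, f (Suc i)) \<in> R"
    using n unfolding relpow_fun_conv by blast
  have "f i \<noteq> f j" if "i < j" "j \<le> n" for i j
  proof
    assume eq: "f i = f j"
    have "(x, f i) \<in> R ^^ i"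
      unfolding relpow_fun_conv using f that by (intro exI[of _ f]) auto
    moreover have "(f j, y) \<in> R ^^ (n - j)"
      unfolding relpow_fun_conv using f that by (intro exI[of _ "\<lambda>m. f (j + m)"]) auto
    ultimately have "(x, y) \<in> R ^^ (i + (n - j))"
      unfolding relpow_add eq by blast
    then have "n \<le> i + (n - j)" unfolding n_def by (rule Least_le)
    then show False using that by simp
  qed
  then have "inj_on f {..n}"
    by (intro linorder_inj_onI') auto
  then show ?thesis using f that by blast
qed

lemma frontier_meets_ray:
  fixes a u :: "'a::real_normed_vector"
  assumes out: "- cball 0 R \<subseteq> C" and a: "a \<notin> C" and u: "u \<noteq> 0"
  obtains t where "t \<ge> 0" "a + t *\<^sub>R u \<in> frontier C"
proof -
  \<comment> \<open>The displacement \<open>T *\<^sub>R u\<close> has norm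
    \<open>\<bar>R\<bar> + norm a + 1\<close>, which puts the end of the segment outside
    \<open>cball 0 R\<close>.\<close>
  define T where "T = (\<bar>R\<bar> + norm a + 1) / norm u"
  have T: "T > 0" using u by (auto simp: T_def intro!: divide_pos_pos add_nonneg_pos)
  have "norm (T *\<^sub>R u) = \<bar>R\<bar> + norm a + 1" using u by (simp add: T_def)
  then have "norm (a + T *\<^sub>R u) > R"
    using norm_triangle_ineq4[of "a + T *\<^sub>R u" a] by simp
  then have "a + T *\<^sub>R u \<in> C" using out by auto
  then have "closed_segment a (a + T *\<^sub>R u) \<inter> frontier C \<noteq> {}"
    using a by (intro connected_Int_frontier connected_segment) auto
  then obtain y where y: "y \<in> closed_segment a (a + T *\<^sub>R u)" "y \<in> frontier C" by blast
  then obtain s where s: "0 \<le> s" "y = (1 - s) *\<^sub>R a + s *\<^sub>R (a + T *\<^sub>R u)"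
    by (auto simp: in_segment)
  then have "y = a + (s * T) *\<^sub>R u" by (simp add: algebra_simps)
  then show ?thesis using that[of "s * T"] s T y by auto
qed

text \<open>The line passes through the centre of the cube at 0, so its other coordinates are 1/2,
  strictly between integers. This forces \<open>z\<close> onto the axis.\<close>

lemma axis_cube:
  fixes e z :: "'a::euclidean_space"
  assumes e: "e \<in> Basis" and z: "z \<in> lattice" and y: "(1 / 2) *\<^sub>R One + t *\<^sub>R e \<in> cube z"
  obtains k :: int where "z = of_int k *\<^sub>R e" "k \<le> 1 / 2 + t" "1 / 2 + t \<le> k + 1"
proof -
  have coord: "((1 / 2) *\<^sub>R One + t *\<^sub>R e) \<bullet> b = 1 / 2 + (if b = e then t else 0)" if "b \<in> Basis" for b
    using that e by (auto simp: inner_add_left inner_Basis)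
  obtain k where k: "z \<bullet> e = of_int k" using z e by (rule lattice_coordinate)
  have "z \<bullet> b = (of_int k *\<^sub>R e) \<bullet> b" if b: "b \<in> Basis" for b
  proof (cases "b = e")
    case False
    obtain m where m: "z \<bullet> b = of_int m" using z b by (rule lattice_coordinate)
    have "of_int m \<le> (1 / 2 :: real)" "(1 / 2 :: real) \<le> of_int m + 1"
      using y b coord[OF b] m False by (auto simp: mem_cube)
    then have "m = 0" by linarith
    then show ?thesis using m False e b by (simp add: inner_Basis)
  qed (use k e in simp)
  then have "z = of_int k *\<^sub>R e" by (rule euclidean_eqI)
  moreover have "k \<le> 1 / 2 + t" "1 / 2 + t \<le> k + 1"
    using y e coord[OF e] k by (auto simp: mem_cube)
  ultimately show ?thesis using that by blast
qed

text \<open>A bounded component would have a connected outer boundary covered by vacant cubes, which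
  are therefore linked by star-steps. This boundary meets the axis on both sides of the origin, so
  some vacant path leads from \<open>k *\<^sub>R e\<close> with \<open>k \<ge> 1\<close> to a
  nonpositive multiple of \<open>e\<close>. Such a path has at least \<open>k\<close> steps, and its
  first \<open>k\<close> steps contradict \<open>no_path\<close>.\<close>

lemma unbounded_component_if_no_vacant_path:
  fixes Occ :: "'a::euclidean_space set"
  assumes dim: "DIM('a) \<ge> 2" and e: "e \<in> Basis" and Occ: "Occ \<subseteq> lattice"
    and no_path: "\<And>k w. w 0 = of_nat k *\<^sub>R e \<Longrightarrow> (\<And>i. i < k \<Longrightarrow> w (Suc i) - w i \<in> steps) \<Longrightarrow>
      inj_on w {..k} \<Longrightarrow> \<exists>i\<le>k. w i \<in> Occ"
  shows "\<not> bounded (connected_component_set (\<Union>z\<in>Occ. cube z) 0)"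
proof
  define U where "U = (\<Union>z\<in>Occ. cube z)"
  define S where "S = connected_component_set U 0"
  assume "bounded (connected_component_set (\<Union>z\<in>Occ. cube z) 0)"
  then have bS: "bounded S" by (simp add: S_def U_def)
  \<comment> \<open>The path without steps shows that the origin is occupied.\<close>
  have zero: "0 \<in> Occ" using no_path[of "\<lambda>_. 0" 0] by simp
  have conn_cube: "connected (cube z)" for z :: 'a
    unfolding cube_def by (intro convex_connected convex_box)
  have absorb: "cube z \<subseteq> S" if z: "z \<in> Occ" "y \<in> cube z" "y \<in> S" for z y
  proof -
    have "connected_component_set U y = S"
      using z(3) connected_component_eq unfolding S_def by blast
    moreover have "cube z \<subseteq> connected_component_set U y"
      using z by (intro connected_component_maximal conn_cube) (auto simp: U_def)
    ultimately show ?thesis by simp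
  qed
  have "cube 0 \<subseteq> S"
    unfolding S_def using zero
    by (intro connected_component_maximal conn_cube) (auto simp: U_def mem_cube)
  then have center: "(1 / 2) *\<^sub>R One \<in> S" by (auto simp: mem_cube)
  have "S = (\<Union>z\<in>{z \<in> Occ. cube z \<inter> S \<noteq> {}}. cube z)"
  proof (intro equalityI subsetI)
    fix y assume y: "y \<in> S"
    then have "y \<in> U" using connected_component_subset S_def by blast
    then show "y \<in> (\<Union>z\<in>{z \<in> Occ. cube z \<inter> S \<noteq> {}}. cube z)" using y by (auto simp: U_def)
  qed (use absorb in blast)
  moreover have "finite {z \<in> Occ. cube z \<inter> S \<noteq> {}}"
    by (rule finite_subset[OF _ finite_cubes_meeting_bounded[OF bS]]) (use Occ in auto)
  moreover have closed_cube: "closed (cube z)" for z :: 'a unfolding cube_def by (rule closed_cbox)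
  ultimately have cS: "closed S" using closed_UN[of "{z \<in> Occ. cube z \<inter> S \<noteq> {}}" cube] by simp
  have connS: "connected S" by (simp add: S_def)

  obtain R where R: "S \<subseteq> cball 0 R" using bS unfolding bounded_iff by (metis mem_cball_0 subsetI)
  define y0 where "y0 = (\<bar>R\<bar> + 1) *\<^sub>R e"
  have y0: "norm y0 > R" using e by (simp add: y0_def)
  \<comment> \<open>The unbounded component of the complement. In dimension at least 2 the outside
    of a ball is connected, so \<open>C\<close> contains all of it.\<close>
  define C where "C = connected_component_set (- S) y0"
  have out: "- cball 0 R \<subseteq> C"
    unfolding C_def using dim y0 R
    by (intro connected_component_maximal connected_complement_bounded_convex) auto
  have CS: "C \<subseteq> - S" unfolding C_def by (rule connected_component_subset)
  have "C \<in> components (- S)"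
    unfolding C_def using y0 R by (intro componentsI) auto
  then have connF: "connected (frontier C)"
    by (rule connected_frontier_component_complement[OF connS])
  have "frontier C \<subseteq> frontier (- S)"
    unfolding C_def by (rule frontier_of_connected_component_subset)
  then have "frontier C \<subseteq> frontier S" by (simp add: frontier_complement)
  moreover have "frontier S \<subseteq> S" using cS by (rule frontier_subset_closed)
  moreover have "frontier S \<inter> interior S = {}" by (auto simp: frontier_def)
  ultimately have FS: "frontier C \<subseteq> S" "frontier C \<inter> interior S = {}" by blast+
  define W where "W = {z \<in> lattice - Occ. cube z \<inter> frontier C \<noteq> {}}"
  have "bounded (frontier C)" using FS(1) bS by (rule bounded_subset[rotated])
  then have finW: "finite W"
    by (rule finite_subset[OF _ finite_cubes_meeting_bounded, rotated]) (auto simp: W_def)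
  \<comment> \<open>The cubes containing \<open>y\<close> form a neighbourhood of \<open>y\<close>.
    If all of them were occupied, they would be absorbed by \<open>S\<close>, and \<open>y\<close>
    would be interior to \<open>S\<close>.\<close>
  have vacant: "\<exists>z\<in>W. y \<in> cube z" if y: "y \<in> frontier C" for y
  proof (rule ccontr)
    assume no: "\<not> ?thesis"
    have occ: "z \<in> Occ" if "z \<in> lattice" "y \<in> cube z" for z
      using no y that by (auto simp: W_def)
    define Z where "Z = {z \<in> lattice. cube z \<inter> ball y 1 \<noteq> {}} - {z. y \<in> cube z}"
    have "closed (\<Union>z\<in>Z. cube z)"
      unfolding Z_def by (intro closed_UN ballI closed_cube finite_Diff finite_cubes_meeting_bounded bounded_ball)
    then have "open (ball y 1 - (\<Union>z\<in>Z. cube z))" by (intro open_Diff open_ball)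
    moreover have "y \<in> ball y 1 - (\<Union>z\<in>Z. cube z)" by (auto simp: Z_def)
    moreover have "ball y 1 - (\<Union>z\<in>Z. cube z) \<subseteq> S"
    proof
      fix x assume x: "x \<in> ball y 1 - (\<Union>z\<in>Z. cube z)"
      obtain z where z: "z \<in> lattice" "x \<in> cube z" by (rule cubes_cover)
      have "y \<in> cube z" using x z unfolding Z_def by blast
      then show "x \<in> S" using absorb[OF occ[OF z(1)]] z y FS(1) by blast
    qed
    ultimately have "y \<in> interior S" by (rule interiorI)
    then show False using y FS(2) by blast
  qed
  define E where "E = {(z, z'). z \<in> W \<and> z' \<in> W \<and> z' - z \<in> steps}"
  \<comment> \<open>Reachable and unreachable vacant cubes would split the connected frontier into
    two disjoint closed pieces.\<close>
  have reach: "(z, z') \<in> E\<^sup>*" if z: "z \<in> W" and z': "z' \<in> W" for z z'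
  proof (rule ccontr)
    assume no: "(z, z') \<notin> E\<^sup>*"
    let ?A = "\<Union>w\<in>{w \<in> W. (z, w) \<in> E\<^sup>*}. cube w" and ?B = "\<Union>w\<in>{w \<in> W. (z, w) \<notin> E\<^sup>*}. cube w"
    have "closed ?A" "closed ?B" using finW by (auto intro!: closed_UN closed_cube)
    moreover have "frontier C \<subseteq> ?A \<union> ?B" using vacant by blast
    moreover have "?A \<inter> ?B = {}"
    proof (rule ccontr)
      assume "?A \<inter> ?B \<noteq> {}"
      then obtain v w where vw: "v \<in> W" "w \<in> W" "(z, v) \<in> E\<^sup>*" "(z, w) \<notin> E\<^sup>*" "cube v \<inter> cube w \<noteq> {}"
        by blast
      then have "w - v \<in> steps" by (intro diff_in_steps) (auto simp: W_def)
      then have "(v, w) \<in> E" using vw by (simp add: E_def)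
      then show False using vw(3,4) by (meson rtrancl.rtrancl_into_rtrancl)
    qed
    moreover have "?A \<inter> frontier C \<noteq> {}" using z by (force simp: W_def)
    moreover have "?B \<inter> frontier C \<noteq> {}" using z' no by (force simp: W_def)
    ultimately show False using connF connected_closedD[of "frontier C" ?A ?B] by blast
  qed
  have nC: "(1 / 2) *\<^sub>R One \<notin> C" using center CS by blast
  have ne: "e \<noteq> 0" using e by auto

  obtain t where t: "t \<ge> 0" "(1 / 2) *\<^sub>R One + t *\<^sub>R e \<in> frontier C"
    by (rule frontier_meets_ray[OF out nC ne])
  obtain z where z: "z \<in> W" "(1 / 2) *\<^sub>R One + t *\<^sub>R e \<in> cube z" using vacant[OF t(2)] by blast
  obtain k where k: "z = of_int k *\<^sub>R e" "1 / 2 + t \<le> real_of_int k + 1"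
    using axis_cube[OF e _ z(2)] z(1) by (auto simp: W_def)
  have "k \<noteq> 0" using z(1) zero k by (auto simp: W_def)
  then have "k \<ge> 1" using k(2) t(1) by linarith
  obtain t' where t': "t' \<ge> 0" "(1 / 2) *\<^sub>R One + t' *\<^sub>R (- e) \<in> frontier C"
    by (rule frontier_meets_ray[OF out nC, of "- e"]) (use ne in auto)
  obtain z' where z': "z' \<in> W" "(1 / 2) *\<^sub>R One + (- t') *\<^sub>R e \<in> cube z'" using vacant[OF t'(2)] by auto
  obtain k' where k': "z' = of_int k' *\<^sub>R e" "real_of_int k' \<le> 1 / 2 - t'"
    using axis_cube[OF e _ z'(2)] z'(1) by (auto simp: W_def)
  have "k' \<le> 0" using k'(2) t'(1) by linarith

  obtain f n where f: "f 0 = z" "f n = z'" "\<And>i. i < n \<Longrightarrow> (f i, f (Suc i)) \<in> E" "inj_on f {..n}"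
    using rtrancl_simple_path[OF reach[OF z(1) z'(1)]] by blast
  \<comment> \<open>A star-step changes the coordinate along \<open>e\<close> by at most 1, so
    descending from \<open>k\<close> to \<open>k' \<le> 0\<close> takes at least \<open>k\<close>
    steps.\<close>
  have step: "f i \<bullet> e \<ge> real_of_int k - real i" if "i \<le> n" for i
    using that
  proof (induction i)
    case (Suc i)
    then have "f (Suc i) - f i \<in> steps" using f(3)[of i] by (auto simp: E_def)
    then have "\<bar>f (Suc i) \<bullet> e - f i \<bullet> e\<bar> \<le> 1" using e by (auto simp: steps_def inner_diff_left)
    then show ?case using Suc by simp
  qed (use f(1) k e in auto)
  have "real_of_int k' \<ge> real_of_int k - real n" using step[of n] f(2) k' e by simp
  then have kn: "nat k \<le> n" using \<open>k' \<le> 0\<close> by linarith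
  have "\<exists>i\<le>nat k. f i \<in> Occ"
  proof (rule no_path)
    show "f 0 = of_nat (nat k) *\<^sub>R e" using f(1) k(1) \<open>k \<ge> 1\<close> by simp
    show "f (Suc i) - f i \<in> steps" if "i < nat k" for i
      using f(3)[of i] that kn by (auto simp: E_def)
    show "inj_on f {..nat k}" by (rule inj_on_subset[OF f(4)]) (use kn in auto)
  qed
  moreover have "f i \<in> W" if "i \<le> n" for i
    using that f(1,3) z(1) by (cases i) (auto simp: E_def)
  ultimately show False using kn by (auto simp: W_def)
qed

section \<open>From occupied cells to percolation\<close>

text \<open>Open boxes make the cells of distinct lattice points disjoint, hence independent; the
  second factor admits only large radii.\<close>

definition cell :: "real \<Rightarrow> real \<Rightarrow> 'a::euclidean_space \<Rightarrow> ('a \<times> real) set" where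
  "cell a r z = box (a *\<^sub>R z) (a *\<^sub>R (z + One)) \<times> {r..}"

lemma cells_disjoint:
  fixes z w :: "'a::euclidean_space"
  assumes "z \<in> lattice" "w \<in> lattice" "z \<noteq> w" "a > 0"
  shows "cell a r z \<inter> cell a r w = {}"
proof -
  obtain b where b: "b \<in> Basis" "z \<bullet> b \<noteq> w \<bullet> b"
    using assms(3) euclidean_eqI[of z w] by blast
  obtain k where k: "z \<bullet> b = real_of_int k" using assms(1) b(1) by (rule lattice_coordinate)
  obtain m where m: "w \<bullet> b = real_of_int m" using assms(2) b(1) by (rule lattice_coordinate)
  have "k + 1 \<le> m \<or> m + 1 \<le> k" using b(2) k m by auto
  then have "(z + One) \<bullet> b \<le> w \<bullet> b \<or> (w + One) \<bullet> b \<le> z \<bullet> b"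
    using b(1) k m by (auto simp: inner_add_left)
  then have le: "(a *\<^sub>R (z + One)) \<bullet> b \<le> (a *\<^sub>R w) \<bullet> b \<or> (a *\<^sub>R (w + One)) \<bullet> b \<le> (a *\<^sub>R z) \<bullet> b"
    using assms(4) by auto
  have "box (a *\<^sub>R z) (a *\<^sub>R (z + One)) \<inter> box (a *\<^sub>R w) (a *\<^sub>R (w + One)) = {}"
    using le b(1) by (fastforce simp: mem_box simp del: inner_scaleR_left)
  then show ?thesis by (auto simp: cell_def)
qed

text \<open>Two points of a closed cube of side \<open>a\<close> differ by at most \<open>a\<close>
  in each coordinate, so their distance is at most \<open>d * a < r\<close>. One large ball centred
  in the cell covers the whole scaled cube.\<close>

lemma cube_covered:
  fixes z :: "'a::euclidean_space"
  assumes a: "0 < a" "real (DIM('a)) * a < r" and p: "p \<in> X" "p \<in> cell a r z"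
  shows "(*\<^sub>R) a ` cube z \<subseteq> covered_set X"
proof
  fix x assume "x \<in> (*\<^sub>R) a ` cube z"
  then obtain y where y: "y \<in> cube z" "x = a *\<^sub>R y" by blast
  have "\<bar>(fst p - x) \<bullet> b\<bar> \<le> a" if b: "b \<in> Basis" for b
  proof -
    have "a * (z \<bullet> b) \<le> fst p \<bullet> b" "fst p \<bullet> b \<le> a * (z \<bullet> b) + a"
      using p(2) b by (auto simp: cell_def mem_Times_iff mem_box inner_add_left distrib_left less_imp_le)
    moreover have "a * (z \<bullet> b) \<le> a * (y \<bullet> b)" "a * (y \<bullet> b) \<le> a * (z \<bullet> b) + a"
      using y(1) b a(1) mult_left_mono[of "y \<bullet> b" "z \<bullet> b + 1" a] by (auto simp: mem_cube distrib_left)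
    ultimately show ?thesis by (auto simp: y(2) inner_diff_left abs_le_iff)
  qed
  then have "(\<Sum>b\<in>Basis. \<bar>(fst p - x) \<bullet> b\<bar>) \<le> real (DIM('a)) * a"
    using sum_bounded_above[of Basis "\<lambda>b. \<bar>(fst p - x) \<bullet> b\<bar>" a] by simp
  then have "dist (fst p) x < r"
    using norm_le_l1[of "fst p - x"] a(2) by (simp add: dist_norm)
  moreover have "r \<le> snd p" using p(2) by (simp add: cell_def mem_Times_iff)
  ultimately show "x \<in> covered_set X" using p(1) by (auto simp: mem_covered_set intro!: bexI[of _ p])
qed

lemma percolates_if_no_vacant_path:
  fixes X :: "('a::euclidean_space \<times> real) set"
  assumes dim: "DIM('a) \<ge> 2" and e: "e \<in> Basis" and a: "0 < a" "real (DIM('a)) * a < r"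
    and no_path: "\<And>k w. w 0 = of_nat k *\<^sub>R e \<Longrightarrow> (\<And>i. i < k \<Longrightarrow> w (Suc i) - w i \<in> steps) \<Longrightarrow>
      inj_on w {..k} \<Longrightarrow> \<exists>i\<le>k. X \<inter> cell a r (w i) \<noteq> {}"
  shows "percolates X"
proof -
  define Occ where "Occ = {z \<in> lattice. X \<inter> cell a r z \<noteq> {}}"
  let ?U = "\<Union>z\<in>Occ. cube z"
  let ?S = "connected_component_set ?U 0"
  have unbounded: "\<not> bounded ?S"
  proof (rule unbounded_component_if_no_vacant_path[OF dim e])
    fix k :: nat and w :: "nat \<Rightarrow> 'a"
    assume w: "w 0 = of_nat k *\<^sub>R e" "\<And>i. i < k \<Longrightarrow> w (Suc i) - w i \<in> steps" "inj_on w {..k}"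
    then obtain i where i: "i \<le> k" "X \<inter> cell a r (w i) \<noteq> {}" using no_path[of w k] by blast
    have "w i \<in> lattice" if "i \<le> k" for i
      using that
    proof (induction i)
      case 0
      then show ?case using w(1) e by (auto simp: lattice_def inner_Basis)
    next
      case (Suc i)
      then have "w i \<in> lattice" "w (Suc i) - w i \<in> lattice" using w(2)[of i] by (auto simp: steps_def)
      then have "w i + (w (Suc i) - w i) \<in> lattice"
        by (simp only: lattice_def mem_Collect_eq inner_add_left Ints_add ball_simps simp_thms) (auto intro: Ints_add)
      then show ?case by simp
    qed
    then show "\<exists>i\<le>k. w i \<in> Occ" using i by (auto simp: Occ_def)
  qed (auto simp: Occ_def)
  have "(*\<^sub>R) a ` ?U \<subseteq> covered_set X"
    using cube_covered[OF a] by (fastforce simp: Occ_def)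
  then have "(*\<^sub>R) a ` ?S \<subseteq> covered_set X"
    using connected_component_subset[of ?U 0] by blast
  moreover have "connected ((*\<^sub>R) a ` ?S)"
    by (intro connected_continuous_image continuous_intros connected_connected_component)
  moreover have "0 \<in> (*\<^sub>R) a ` ?S"
  proof -
    have "?S \<noteq> {}" using unbounded by (metis bounded_empty)
    then have "0 \<in> ?U" using connected_component_eq_empty by blast
    then have "0 \<in> ?S" by simp
    then show ?thesis by (intro image_eqI[of _ _ 0]) auto
  qed
  ultimately have "(*\<^sub>R) a ` ?S \<subseteq> connected_component_set (covered_set X) 0"
    by (intro connected_component_maximal) auto
  moreover have "\<not> bounded ((*\<^sub>R) a ` ?S)"
  proof
    assume "bounded ((*\<^sub>R) a ` ?S)"
    then have "bounded ((*\<^sub>R) (1 / a) ` ((*\<^sub>R) a ` ?S))" by (rule bounded_scaling)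
    then show False using unbounded a(1) by (simp add: image_image)
  qed
  ultimately show ?thesis
    unfolding percolates_def using bounded_subset by blast
qed

section \<open>Probability of vacant paths and the necessity of (A1)\<close>

context boolean_model
begin

lemma cell_in_sets:
  fixes z :: 'a
  assumes "r > 0"
  shows "cell a r z \<in> sets \<nu>"
  unfolding cell_def using assms by (intro in_sets borel_Times) auto

lemma emeasure_cell:
  fixes z :: 'a
  assumes "r > 0" "a > 0"
  shows "emeasure \<nu> (cell a r z) = ennreal (lam * a ^ DIM('a)) * emeasure \<mu> {r..}"
proof -
  interpret sigma_finite_measure \<mu>
    by (rule sigma_finite_locally_finite_on_pos[OF locally_finite])
  have "emeasure lborel (box (a *\<^sub>R z) (a *\<^sub>R (z + One))) = ennreal (a ^ DIM('a))"
  proof -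
    have "emeasure lborel (box (a *\<^sub>R z) (a *\<^sub>R (z + One))) =
        (\<Prod>b\<in>Basis. (a *\<^sub>R (z + One) - a *\<^sub>R z) \<bullet> b)"
      using assms by (intro emeasure_lborel_box) (auto simp: inner_add_left)
    also have "(\<Prod>b\<in>Basis. (a *\<^sub>R (z + One) - a *\<^sub>R z) \<bullet> b) = (\<Prod>b\<in>(Basis::'a set). a)"
      by (intro prod.cong) (auto simp: inner_add_left inner_diff_left algebra_simps)
    finally show ?thesis by simp
  qed
  then show ?thesis
    unfolding boolean_intensity_def cell_def using lam_pos assms
    by (subst emeasure_pair_measure_Times)
      (auto simp: ennreal_mult' intro!: in_sets_locally_finite_on_pos[OF locally_finite])
qed

lemma prob_void_cells:
  assumes r: "r > 0" and a: "a > 0" and q: "\<And>z. prob (void (cell a r z)) \<le> q"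
    and Z: "finite Z" "Z \<subseteq> lattice"
  shows "prob (void (\<Union>z\<in>Z. cell a r z)) \<le> q ^ card Z"
  using Z
proof (induction Z rule: finite_induct)
  case (insert z Z)
  have q0: "0 \<le> q" using q[of z] measure_nonneg[of M] by (rule order_trans[rotated])
  have U: "(\<Union>z\<in>Z. cell a r z) \<in> sets \<nu>"
    using insert.hyps cell_in_sets[OF r] by (intro sets.finite_UN) auto
  have "cell a r z \<inter> (\<Union>z\<in>Z. cell a r z) = {}"
    using insert.prems insert.hyps cells_disjoint[OF _ _ _ a, of z] by blast
  then have "prob (void (\<Union>z\<in>insert z Z. cell a r z)) =
      prob (void (cell a r z)) * prob (void (\<Union>z\<in>Z. cell a r z))"
    using prob_void_Un[OF cell_in_sets[OF r] U] by simp
  also have "\<dots> \<le> q * q ^ card Z"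
    using insert q q0 by (intro mult_mono) auto
  finally show ?case using insert.hyps by simp
qed simp

text \<open>With \<open>N\<close> the number of steps, at most \<open>N ^ k\<close> simple paths
  with \<open>k\<close> steps start at \<open>k *\<^sub>R e\<close>, each vacant with probability at
  most \<open>q ^ (k + 1)\<close>. Since \<open>N * q = 1 / 4\<close> and \<open>N \<ge> 1\<close>,
  summing over \<open>k\<close> gives at most \<open>4 / 3 * q \<le> 1 / 3\<close>, so with positive
  probability no such vacant path exists.\<close>

lemma percolation_not_null_if_dense:
  assumes dim: "DIM('a) \<ge> 2" and r: "r > 0" and a: "0 < a" "real (DIM('a)) * a < r"
    and q: "\<And>z. prob (void (cell a r z)) \<le> q" and q_small: "4 * real (card (steps :: 'a set)) * q = 1"
  shows "{\<omega> \<in> space M. percolates (\<xi> \<omega>)} \<notin> null_sets M"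
proof
  assume null: "{\<omega> \<in> space M. percolates (\<xi> \<omega>)} \<in> null_sets M"
  let ?N = "real (card (steps :: 'a set))"
  obtain e :: 'a where e: "e \<in> Basis" using nonempty_Basis by blast
  \<comment> \<open>Paths are encoded by their increments, which makes counting them a matter of
    counting functions into \<open>steps\<close>.\<close>
  define site where "site k s i = of_nat k *\<^sub>R e + (\<Sum>j<i. s j)" for k :: nat and s :: "nat \<Rightarrow> 'a" and i
  define paths where "paths k = {s \<in> {..<k} \<rightarrow>\<^sub>E steps. inj_on (site k s) {..k}}" for k
  define V where "V k s = void (\<Union>z\<in>site k s ` {..k}. cell a r z)" for k s
  define E where "E k = (\<Union>s\<in>paths k. V k s)" for k
  have N: "?N \<ge> 1"
    using zero_in_steps finite_steps card_gt_0_iff[of "steps :: 'a set"] by (auto simp: Suc_le_eq)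
  have q0: "q > 0" using q_small N by (metis zero_less_mult_pos zero_less_one mult_pos_pos less_le_trans zero_less_numeral)
  have qN: "?N * q = 1 / 4" using q_small by simp
  have fin: "finite ({..<k} \<rightarrow>\<^sub>E (steps :: 'a set))" for k :: nat
    by (intro finite_PiE finite_steps) auto
  then have finp: "finite (paths k)" for k by (simp add: paths_def)
  have V: "V k s \<in> events" for k s
    unfolding V_def using cell_in_sets[OF r] by (intro void_in_events sets.finite_UN) auto
  have E: "E k \<in> events" for k unfolding E_def using finp V by (intro sets.finite_UN) auto
  have site_lattice: "site k s i \<in> lattice" if s: "s \<in> paths k" and i: "i \<le> k" for k s i
  proof -
    have "s j \<bullet> b \<in> \<int>" if "j < i" "b \<in> Basis" for j b
      using s i that by (auto simp: paths_def PiE_iff steps_def lattice_def)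
    then show ?thesis
      using e by (auto simp: site_def lattice_def inner_add_left inner_sum_left inner_Basis intro!: Ints_add Ints_sum)
  qed
  have bound: "prob (E k) \<le> (1 / 4) ^ k * q" for k
  proof -
    have "prob (E k) \<le> (\<Sum>s\<in>paths k. prob (V k s))"
      unfolding E_def using finp V by (intro finite_measure_subadditive_finite) auto
    \<comment> \<open>A simple path with \<open>k\<close> steps visits \<open>k + 1\<close> distinct
      cells.\<close>
    also have "\<dots> \<le> (\<Sum>s\<in>paths k. q ^ Suc k)"
    proof (intro sum_mono)
      fix s assume s: "s \<in> paths k"
      then have "card (site k s ` {..k}) = Suc k" by (simp add: paths_def card_image)
      moreover have "prob (V k s) \<le> q ^ card (site k s ` {..k})"
        unfolding V_def using site_lattice[OF s] by (intro prob_void_cells[OF r a(1) q]) auto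
      ultimately show "prob (V k s) \<le> q ^ Suc k" by simp
    qed
    also have "\<dots> = real (card (paths k)) * q ^ Suc k" by simp
    also have "\<dots> \<le> ?N ^ k * q ^ Suc k"
    proof (intro mult_right_mono)
      have "card (paths k) \<le> card ({..<k} \<rightarrow>\<^sub>E (steps :: 'a set))"
        using fin by (intro card_mono) (auto simp: paths_def)
      also have "\<dots> = card (steps :: 'a set) ^ k" by (simp add: card_PiE)
      finally show "real (card (paths k)) \<le> ?N ^ k" by (metis of_nat_le_iff of_nat_power)
    qed (use q0 in auto)
    also have "\<dots> = (?N * q) ^ k * q" by (simp add: power_mult_distrib)
    finally show ?thesis by (simp add: qN)
  qed
  have sums: "(\<lambda>k. (1 / 4) ^ k * q) sums (4 / 3 * q)"
    using sums_mult2[OF geometric_sums[of "1 / 4 :: real"], of q] by simp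
  have summ: "summable (\<lambda>k. prob (E k))"
    using bound by (intro summable_comparison_test[OF _ sums_summable[OF sums]]) auto
  have "prob (\<Union>k. E k) \<le> (\<Sum>k. prob (E k))"
    using E summ by (intro finite_measure_subadditive_countably) auto
  also have "\<dots> \<le> 4 / 3 * q"
    using suminf_le[OF bound summ sums_summable[OF sums]] sums_unique[OF sums] by simp
  also have "\<dots> < 1"
    using mult_right_mono[OF N, of q] q0 qN by simp
  finally have lt: "prob (\<Union>k. E k) < 1" .
  have "space M \<subseteq> {\<omega> \<in> space M. percolates (\<xi> \<omega>)} \<union> (\<Union>k. E k)"
  proof
    fix \<omega> assume \<omega>: "\<omega> \<in> space M"
    show "\<omega> \<in> {\<omega> \<in> space M. percolates (\<xi> \<omega>)} \<union> (\<Union>k. E k)"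
    proof (cases "\<omega> \<in> (\<Union>k. E k)")
      case False
      have "percolates (\<xi> \<omega>)"
      proof (rule percolates_if_no_vacant_path[OF dim e a])
        fix k :: nat and w :: "nat \<Rightarrow> 'a"
        assume w: "w 0 = of_nat k *\<^sub>R e" "\<And>i. i < k \<Longrightarrow> w (Suc i) - w i \<in> steps" "inj_on w {..k}"
        define s where "s = restrict (\<lambda>j. w (Suc j) - w j) {..<k}"
        have site: "site k s i = w i" if "i \<le> k" for i
        proof -
          have "(\<Sum>j<i. s j) = (\<Sum>j<i. w (Suc j) - w j)"
            using that by (intro sum.cong) (auto simp: s_def)
          also have "\<dots> = w i - w 0" by (rule sum_lessThan_telescope)
          finally show ?thesis using w(1) by (simp add: site_def)
        qed
        have "inj_on (site k s) {..k} \<longleftrightarrow> inj_on w {..k}"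
          using site by (intro inj_on_cong) auto
        then have "s \<in> paths k"
          using w(2,3) by (auto simp: paths_def s_def)
        then have "\<omega> \<notin> V k s" using False by (auto simp: E_def)
        then show "\<exists>i\<le>k. \<xi> \<omega> \<inter> cell a r (w i) \<noteq> {}"
          using \<omega> site by (fastforce simp: V_def void_def)
      qed
      then show ?thesis using \<omega> by simp
    qed auto
  qed
  then have "prob (space M) \<le> prob ({\<omega> \<in> space M. percolates (\<xi> \<omega>)} \<union> (\<Union>k. E k))"
    using E null by (intro finite_measure_mono) auto
  also have "\<dots> \<le> prob {\<omega> \<in> space M. percolates (\<xi> \<omega>)} + prob (\<Union>k. E k)"
    using E null by (intro measure_Un_le) auto
  also have "prob {\<omega> \<in> space M. percolates (\<xi> \<omega>)} = 0"
    using null by (auto simp: null_sets_def emeasure_eq_measure)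
  finally show False using lt prob_space by simp
qed

lemma percolation_not_null_if_not_A1:
  assumes dim: "DIM('a) \<ge> 2" and A1: "\<not> A1 (DIM('a)) \<mu>"
  shows "{\<omega> \<in> space M. percolates (\<xi> \<omega>)} \<notin> null_sets M"
proof -
  let ?d = "DIM('a)"
  let ?N = "real (card (steps :: 'a set))"
  have N: "?N \<ge> 1"
    using zero_in_steps finite_steps card_gt_0_iff[of "steps :: 'a set"] by (auto simp: Suc_le_eq)
  define q where "q = 1 / (4 * ?N)"
  \<comment> \<open>Chosen so that \<open>r ^ d * \<mu> {r..} > T\<close> makes the intensity of a
    cell at least \<open>ln (4 * N)\<close>, with \<open>N\<close> the number of steps; a cell is
    then void with probability at most \<open>1 / (4 * N)\<close>.\<close>
  define T where "T = ln (4 * ?N) * (real ?d + 1) ^ ?d / lam"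
  have "top \<le> (SUP r\<in>{0<..}. ennreal (r ^ ?d) * emeasure \<mu> {r..})"
    using A1 by (simp only: A1_def not_less infinity_ennreal_def)
  with ennreal_less_top have "ennreal T < (SUP r\<in>{0<..}. ennreal (r ^ ?d) * emeasure \<mu> {r..})"
    by (rule less_le_trans)
  then obtain r where r: "r > 0" "ennreal T < ennreal (r ^ ?d) * emeasure \<mu> {r..}"
    by (auto simp: less_SUP_iff)
  \<comment> \<open>A side proportional to \<open>r\<close> that satisfies \<open>d * a < r\<close>,
    as \<open>cube_covered\<close> demands.\<close>
  define a where "a = r / (real ?d + 1)"
  have a: "0 < a" "real ?d * a < r" using r(1) by (auto simp: a_def field_simps)
  have "prob (void (cell a r z)) \<le> q" for z
  proof (cases "emeasure \<nu> (cell a r z) < \<infinity>")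
    case True
    have "ennreal (ln (4 * ?N)) = ennreal (lam / (real ?d + 1) ^ ?d) * ennreal T"
      using lam_pos N by (simp add: ennreal_mult[symmetric] T_def)
    also have "\<dots> \<le> ennreal (lam / (real ?d + 1) ^ ?d) * (ennreal (r ^ ?d) * emeasure \<mu> {r..})"
      using r(2) by (intro mult_left_mono) auto
    also have "\<dots> = ennreal (lam * a ^ ?d) * emeasure \<mu> {r..}"
      using lam_pos r(1) by (simp add: a_def power_divide ennreal_mult'[symmetric] mult.assoc[symmetric])
    also have "\<dots> = ennreal (measure \<nu> (cell a r z))"
      using True emeasure_eq_ennreal_measure[of \<nu> "cell a r z"]
      by (simp only: emeasure_cell[OF r(1) a(1)] less_top[symmetric] infinity_ennreal_def not_False_eq_True)
    finally have "ln (4 * ?N) \<le> measure \<nu> (cell a r z)" by (simp add: ennreal_le_iff)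
    then have "exp (- measure \<nu> (cell a r z)) \<le> exp (- ln (4 * ?N))" by simp
    also have "\<dots> = q"
      unfolding exp_minus q_def using N by (subst exp_ln) (auto simp: inverse_eq_divide)
    finally show ?thesis using prob_void_finite[OF cell_in_sets[OF r(1)] True] by simp
  next
    case False
    then have "prob (void (cell a r z)) = 0"
      by (intro prob_void_infinite cell_in_sets r(1)) (simp add: less_top[symmetric])
    then show ?thesis by (simp add: q_def)
  qed
  moreover have "4 * ?N * q = 1" using N by (simp add: q_def)
  ultimately show ?thesis by (rule percolation_not_null_if_dense[OF dim r(1) a])
qed

end

theorem theorem1p1:
  fixes \<mu> :: "real measure"
    and P :: "real \<Rightarrow> 'w measure"
    and \<xi> :: "real \<Rightarrow> 'w \<Rightarrow> ('a::euclidean_space \<times> real) set"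
  assumes "locally_finite_on_pos \<mu>"
    and "\<And>lam. lam > 0 \<Longrightarrow> poisson_point_process (P lam) (\<xi> lam) (boolean_intensity lam \<mu>)"
  shows "(DIM('a) \<ge> 2 \<longrightarrow>
            (has_subcritical_regime P \<xi> \<longleftrightarrow> A1 DIM('a) \<mu> \<and> A2 DIM('a) \<mu>)) \<and>
         (DIM('a) = 1 \<longrightarrow>
            (A1 DIM('a) \<mu> \<and> A2 DIM('a) \<mu> \<longrightarrow> has_subcritical_regime P \<xi>) \<and>
            (has_subcritical_regime P \<xi> \<longrightarrow> A2 DIM('a) \<mu>))"
proof -
  have necessary: "A2 DIM('a) \<mu> \<and> (DIM('a) \<ge> 2 \<longrightarrow> A1 DIM('a) \<mu>)" if "has_subcritical_regime P \<xi>"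
  proof -
    obtain lam0 where lam0: "lam0 > 0"
      "\<And>lam. lam \<in> {0<..<lam0} \<Longrightarrow> {\<omega> \<in> space (P lam). percolates (\<xi> lam \<omega>)} \<in> null_sets (P lam)"
      using \<open>has_subcritical_regime P \<xi>\<close> unfolding has_subcritical_regime_def by blast
    \<comment> \<open>Necessity follows from a single subcritical intensity: if (A2) fails, or if
      (A1) fails in dimension at least 2, percolation is not null for any positive
      intensity.\<close>
    interpret boolean_model "P (lam0 / 2)" "\<xi> (lam0 / 2)" "lam0 / 2" \<mu>
      using lam0(1) assms by unfold_locales auto
    show ?thesis
      using lam0(1) lam0(2)[of "lam0 / 2"] percolation_not_null percolation_not_null_if_not_A1 by auto
  qed
  then show ?thesis
    using subcritical_if_A1_A2[OF assms] by blast
qed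

end
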